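(* Given an input-consistent DFA $\mathcal A=(Q,\Sigma,\delta,s,F)$ satisfying the standing assumptions below, a minimum-size chain partition of $<_{\mathcal A}$ can be computed in $O(n^2\log n)$ time, where $n=|Q|$.
   Context: A DFA is $\mathcal A=(Q,\Sigma,\delta,s,F)$ with finite state set $Q$, finite totally ordered alphabet $\Sigma$, (partial) transition function $\delta$, initial state $s$, final states $F$. Standing assumptions: $s$ has no incoming transitions; every state is reachable from $s$; all transitions entering a given state carry the same label. $I_q=\{\alpha\in\Sigma^*:\delta(s,\alpha)=q\}$. Co-lex order on finite strings: $\epsilon<\alpha$ for nonempty $\alpha$; for $\alpha=\alpha'a$, $\beta=\beta'b$, $\alpha<\beta$ iff $a<b$, or $a=b$ and $\alpha'<\beta'$. The relation $<_{\mathcal A}$ on $Q$: $u<_{\mathcal A}v$ iff $\alpha<\beta$ for all $\alpha\in I_u$, $\beta\in I_v$ (a strict partial order). A chain partition of $<_{\mathcal A}$ is a partition of $Q$ into sets each totally ordered by $<_{\mathcal A}$; minimum-size means using the fewest sets. *)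

theory Defs
  imports Complex_Main "HOL-Library.Landau_Symbols" "HOL-Library.Disjoint_Sets"
begin

section \<open>Deterministic finite automata and their co-lexicographic order\<close>

text \<open>The order on the alphabet is the order of the type of letters.\<close>

record ('q, 'a) dfa =
  states :: "'q set"
  alphabet :: "'a set"
  trans :: "'q \<Rightarrow> 'a \<Rightarrow> 'q option"
  init :: 'q
  finals :: "'q set"

definition wf_dfa :: "('q, 'a::linorder) dfa \<Rightarrow> bool" where
  "wf_dfa A \<longleftrightarrow>
     finite (states A) \<and> finite (alphabet A) \<and> init A \<in> states A \<and> finals A \<subseteq> states A \<and>
     (\<forall>u a v. trans A u a = Some v \<longrightarrow> u \<in> states A \<and> a \<in> alphabet A \<and> v \<in> states A)"

fun trans_word :: "('q, 'a) dfa \<Rightarrow> 'q \<Rightarrow> 'a list \<Rightarrow> 'q option" where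
  "trans_word A u [] = Some u"
| "trans_word A u (a # \<alpha>) =
     (case trans A u a of None \<Rightarrow> None | Some v \<Rightarrow> trans_word A v \<alpha>)"

definition reaching_words :: "('q, 'a) dfa \<Rightarrow> 'q \<Rightarrow> 'a list set" where
  "reaching_words A q = {\<alpha> \<in> lists (alphabet A). trans_word A (init A) \<alpha> = Some q}"

definition init_has_no_incoming :: "('q, 'a) dfa \<Rightarrow> bool" where
  "init_has_no_incoming A \<longleftrightarrow> (\<forall>u a. trans A u a \<noteq> Some (init A))"

definition all_reachable :: "('q, 'a) dfa \<Rightarrow> bool" where
  "all_reachable A \<longleftrightarrow> (\<forall>q \<in> states A. reaching_words A q \<noteq> {})"

definition input_consistent :: "('q, 'a) dfa \<Rightarrow> bool" where
  "input_consistent A \<longleftrightarrow>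
     (\<forall>u a u' a' v. trans A u a = Some v \<and> trans A u' a' = Some v \<longrightarrow> a = a')"

inductive colex_less :: "'a::linorder list \<Rightarrow> 'a list \<Rightarrow> bool" where
  "\<alpha> \<noteq> [] \<Longrightarrow> colex_less [] \<alpha>"
| "a < b \<Longrightarrow> colex_less (\<alpha> @ [a]) (\<beta> @ [b])"
| "colex_less \<alpha> \<beta> \<Longrightarrow> colex_less (\<alpha> @ [a]) (\<beta> @ [a])"

definition state_less :: "('q, 'a::linorder) dfa \<Rightarrow> 'q \<Rightarrow> 'q \<Rightarrow> bool" where
  "state_less A u v \<longleftrightarrow>
     (\<forall>\<alpha> \<in> reaching_words A u. \<forall>\<beta> \<in> reaching_words A v. colex_less \<alpha> \<beta>)"

definition chain_partition :: "('q, 'a::linorder) dfa \<Rightarrow> 'q set set \<Rightarrow> bool" where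
  "chain_partition A \<C> \<longleftrightarrow>
     partition_on (states A) \<C> \<and> (\<forall>C \<in> \<C>. totalp_on C (state_less A))"

definition minimum_chain_partition :: "('q, 'a::linorder) dfa \<Rightarrow> 'q set set \<Rightarrow> bool" where
  "minimum_chain_partition A \<C> \<longleftrightarrow>
     chain_partition A \<C> \<and> (\<forall>\<D>. chain_partition A \<D> \<longrightarrow> card \<C> \<le> card \<D>)"


section \<open>A word RAM\<close>

text \<open>
  Running times refer to the word RAM, presented as a small imperative language: a program is a
  finite piece of syntax over numbered registers and numbered randomly accessible arrays, all of
  whose entries are \<open>w\<close>-bit words. Arithmetic is modulo \<open>2 ^ w\<close>, and every instruction, memory
  access, arithmetic operation and comparison costs one step. A program may touch only finitely
  many arrays, so they can be interleaved in one memory at a constant-factor cost.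
\<close>

record store =
  reg :: "nat \<Rightarrow> nat"
  cell :: "nat \<Rightarrow> nat \<Rightarrow> nat"

datatype aexp =
    Lit nat
  | Reg nat
  | Cell nat aexp
  | Add aexp aexp
  | Sub aexp aexp
  | Mul aexp aexp
  | Quot aexp aexp
  | Rem aexp aexp

datatype bexp =
    Less aexp aexp
  | Equal aexp aexp
  | Neg bexp
  | Conj bexp bexp

datatype com =
    Skip
  | SetReg nat aexp
  | SetCell nat aexp aexp
  | Seq com com
  | If bexp com com
  | While bexp com

fun aval :: "nat \<Rightarrow> store \<Rightarrow> aexp \<Rightarrow> nat" where
  "aval w \<sigma> (Lit c) = c mod 2 ^ w"
| "aval w \<sigma> (Reg x) = reg \<sigma> x"
| "aval w \<sigma> (Cell r e) = cell \<sigma> r (aval w \<sigma> e)"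
| "aval w \<sigma> (Add e f) = (aval w \<sigma> e + aval w \<sigma> f) mod 2 ^ w"
| "aval w \<sigma> (Sub e f) = (aval w \<sigma> e + 2 ^ w - aval w \<sigma> f) mod 2 ^ w"
| "aval w \<sigma> (Mul e f) = (aval w \<sigma> e * aval w \<sigma> f) mod 2 ^ w"
| "aval w \<sigma> (Quot e f) = aval w \<sigma> e div aval w \<sigma> f"
| "aval w \<sigma> (Rem e f) = aval w \<sigma> e mod aval w \<sigma> f"

fun bval :: "nat \<Rightarrow> store \<Rightarrow> bexp \<Rightarrow> bool" where
  "bval w \<sigma> (Less e f) \<longleftrightarrow> aval w \<sigma> e < aval w \<sigma> f"
| "bval w \<sigma> (Equal e f) \<longleftrightarrow> aval w \<sigma> e = aval w \<sigma> f"
| "bval w \<sigma> (Neg b) \<longleftrightarrow> \<not> bval w \<sigma> b"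
| "bval w \<sigma> (Conj b c) \<longleftrightarrow> bval w \<sigma> b \<and> bval w \<sigma> c"

fun acost :: "aexp \<Rightarrow> nat" where
  "acost (Lit c) = 1"
| "acost (Reg x) = 1"
| "acost (Cell r e) = acost e + 1"
| "acost (Add e f) = acost e + acost f + 1"
| "acost (Sub e f) = acost e + acost f + 1"
| "acost (Mul e f) = acost e + acost f + 1"
| "acost (Quot e f) = acost e + acost f + 1"
| "acost (Rem e f) = acost e + acost f + 1"

fun bcost :: "bexp \<Rightarrow> nat" where
  "bcost (Less e f) = acost e + acost f + 1"
| "bcost (Equal e f) = acost e + acost f + 1"
| "bcost (Neg b) = bcost b + 1"
| "bcost (Conj b c) = bcost b + bcost c + 1"

text \<open>
  \<open>exec w P \<sigma> t \<tau>\<close>: with word size \<open>w\<close>, the program \<open>P\<close> started in \<open>\<sigma>\<close> halts after exactly \<open>t\<close>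
  steps in \<open>\<tau>\<close>.
\<close>

inductive exec :: "nat \<Rightarrow> com \<Rightarrow> store \<Rightarrow> nat \<Rightarrow> store \<Rightarrow> bool" for w where
  Skip: "exec w Skip \<sigma> 1 \<sigma>"
| SetReg: "exec w (SetReg x e) \<sigma> (acost e + 1) (\<sigma>\<lparr>reg := (reg \<sigma>)(x := aval w \<sigma> e)\<rparr>)"
| SetCell: "exec w (SetCell r e f) \<sigma> (acost e + acost f + 1)
    (\<sigma>\<lparr>cell := (cell \<sigma>)(r := (cell \<sigma> r)(aval w \<sigma> e := aval w \<sigma> f))\<rparr>)"
| Seq: "exec w P \<sigma> t \<tau> \<Longrightarrow> exec w R \<tau> t' \<tau>' \<Longrightarrow> exec w (Seq P R) \<sigma> (t + t') \<tau>'"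
| IfTrue: "bval w \<sigma> b \<Longrightarrow> exec w P \<sigma> t \<tau> \<Longrightarrow> exec w (If b P R) \<sigma> (bcost b + t + 1) \<tau>"
| IfFalse: "\<not> bval w \<sigma> b \<Longrightarrow> exec w R \<sigma> t \<tau> \<Longrightarrow> exec w (If b P R) \<sigma> (bcost b + t + 1) \<tau>"
| WhileFalse: "\<not> bval w \<sigma> b \<Longrightarrow> exec w (While b P) \<sigma> (bcost b + 1) \<sigma>"
| WhileTrue: "bval w \<sigma> b \<Longrightarrow> exec w P \<sigma> t \<tau> \<Longrightarrow> exec w (While b P) \<tau> t' \<tau>' \<Longrightarrow>
    exec w (While b P) \<sigma> (bcost b + t + t' + 1) \<tau>'"

inductive_cases SkipE: "exec w Skip \<sigma> t \<tau>"
  and SetRegE: "exec w (SetReg x e) \<sigma> t \<tau>"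
  and SetCellE: "exec w (SetCell r e f) \<sigma> t \<tau>"
  and SeqE: "exec w (Seq P R) \<sigma> t \<tau>"
  and IfE: "exec w (If b P R) \<sigma> t \<tau>"
  and WhileE: "exec w (While b P) \<sigma> t \<tau>"

lemma exec_deterministic:
  assumes "exec w P \<sigma> t \<tau>" and "exec w P \<sigma> t' \<tau>'"
  shows "t' = t \<and> \<tau>' = \<tau>"
  using assms
proof (induction arbitrary: t' \<tau>' rule: exec.induct)
  case (Seq P \<sigma> t \<tau> R u \<rho>)
  from Seq.prems obtain t1 \<tau>1 t2 where "t' = t1 + t2" and 1: "exec w P \<sigma> t1 \<tau>1"
    and 2: "exec w R \<tau>1 t2 \<tau>'" by (rule SeqE)
  moreover from Seq.IH(1)[OF 1] have "t1 = t" and "\<tau>1 = \<tau>" by simp_all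
  moreover from 2 have "t2 = u \<and> \<tau>' = \<rho>" unfolding \<open>\<tau>1 = \<tau>\<close> by (rule Seq.IH(2))
  ultimately show ?case by simp
next
  case (IfTrue \<sigma> b P t \<tau> R)
  from IfTrue.prems IfTrue.hyps(1) obtain t1 where "t' = bcost b + t1 + 1" and "exec w P \<sigma> t1 \<tau>'"
    by (auto elim!: IfE[where P = P])
  with IfTrue.IH[of t1 \<tau>'] show ?case by simp
next
  case (IfFalse \<sigma> b R t \<tau> P)
  from IfFalse.prems IfFalse.hyps(1) obtain t1 where "t' = bcost b + t1 + 1" and "exec w R \<sigma> t1 \<tau>'"
    by (auto elim!: IfE[where P = P])
  with IfFalse.IH[of t1 \<tau>'] show ?case by simp
next
  case (WhileFalse \<sigma> b P)
  from WhileFalse.prems show ?case by (rule WhileE) (use WhileFalse.hyps in auto)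
next
  case (WhileTrue \<sigma> b P t \<tau> u \<rho>)
  from WhileTrue.prems obtain t1 \<tau>1 t2 where "t' = bcost b + t1 + t2 + 1"
    and 1: "exec w P \<sigma> t1 \<tau>1" and 2: "exec w (While b P) \<tau>1 t2 \<tau>'"
    by (rule WhileE) (use WhileTrue.hyps(1) in auto)
  moreover from WhileTrue.IH(1)[OF 1] have "t1 = t" and "\<tau>1 = \<tau>" by simp_all
  moreover from 2 have "t2 = u \<and> \<tau>' = \<rho>" unfolding \<open>\<tau>1 = \<tau>\<close> by (rule WhileTrue.IH(2))
  ultimately show ?case by simp
qed (auto elim: SkipE SetRegE SetCellE)


section \<open>Input and output conventions\<close>

text \<open>
  States are presented by an arbitrary numbering \<open>idx\<close>, letters by arbitrary words \<open>code a\<close> in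
  the same order as the letters, and transitions as an edge list \<open>es\<close> in arbitrary order.
\<close>

definition dfa_encoding ::
  "nat \<Rightarrow> ('q, 'a::linorder) dfa \<Rightarrow> ('q \<Rightarrow> nat) \<Rightarrow> ('a \<Rightarrow> nat) \<Rightarrow> ('q \<times> 'a \<times> 'q) list \<Rightarrow> bool" where
  "dfa_encoding w A idx code es \<longleftrightarrow>
     bij_betw idx (states A) {..<card (states A)} \<and>
     strict_mono_on (alphabet A) code \<and> (\<forall>a \<in> alphabet A. code a < 2 ^ w) \<and>
     distinct es \<and> set es = {(u, a, v). trans A u a = Some v}"

definition input_store ::
  "('q, 'a) dfa \<Rightarrow> ('q \<Rightarrow> nat) \<Rightarrow> ('a \<Rightarrow> nat) \<Rightarrow> ('q \<times> 'a \<times> 'q) list \<Rightarrow> store" where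
  "input_store A idx code es =
    \<lparr>reg = (\<lambda>_. 0)(0 := card (states A), 1 := length es, 2 := idx (init A)),
     cell = (\<lambda>_ _. 0)
       (0 := (\<lambda>i. if i < length es then idx (fst (es ! i)) else 0),
        1 := (\<lambda>i. if i < length es then code (fst (snd (es ! i))) else 0),
        2 := (\<lambda>i. if i < length es then idx (snd (snd (es ! i))) else 0),
        3 := (\<lambda>i. if i \<in> idx ` finals A then 1 else 0))\<rparr>"

text \<open>The output is array 4, which assigns to each state number the label of its block.\<close>

definition output_partition :: "('q, 'a) dfa \<Rightarrow> ('q \<Rightarrow> nat) \<Rightarrow> store \<Rightarrow> 'q set set" where
  "output_partition A idx \<tau> =
     (\<lambda>u. {v \<in> states A. cell \<tau> 4 (idx v) = cell \<tau> 4 (idx u)}) ` states A"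

end

theory Submission
  imports Defs "HOL-Library.List_Lexorder"
begin

text \<open>
  A loop at the initial state, labelled by a new smallest letter, pads all words to the same length
  without changing their order. Let \<open>lo L u\<close> and \<open>hi L u\<close> be the smallest and the largest word of
  length \<open>L\<close> that lead into the state \<open>u\<close>. For \<open>L \<ge> 2 * n\<close> the comparison of these words is
  stable, and \<open>u\<close> precedes \<open>v\<close> iff \<open>u \<noteq> v\<close> and \<open>hi L u \<le> lo L v\<close>. So the order is an interval
  order, for which first fit in the order of the left end points yields a minimum chain partition.

  The words are ranked by doubling their length. For each of the \<open>2 * n\<close> extremal words \<open>x\<close> a table
  stores where \<open>x\<close> leads from every state. The extremal word of length \<open>2 * L\<close> into \<open>u\<close> extends the
  one of length \<open>L\<close>, call it \<open>x\<close>, by the best word of length \<open>L\<close> into some state from which \<open>x\<close>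
  leads to \<open>u\<close>. Determinism makes the new table row the composition of two old rows, so that a
  doubling costs \<open>O(n\<^sup>2)\<close> steps and there are \<open>O(log n)\<close> of them.
\<close>

section \<open>Time-bounded execution\<close>

definition runs :: "nat \<Rightarrow> com \<Rightarrow> store \<Rightarrow> nat \<Rightarrow> (store \<Rightarrow> bool) \<Rightarrow> bool" where
  "runs w P \<sigma> B Q \<longleftrightarrow> (\<exists>t \<tau>. exec w P \<sigma> t \<tau> \<and> t \<le> B \<and> Q \<tau>)"

fun written_regs :: "com \<Rightarrow> nat set" where
  "written_regs (SetReg x e) = {x}"
| "written_regs (Seq P R) = written_regs P \<union> written_regs R"
| "written_regs (If b P R) = written_regs P \<union> written_regs R"
| "written_regs (While b P) = written_regs P"
| "written_regs _ = {}"

fun written_arrays :: "com \<Rightarrow> nat set" where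
  "written_arrays (SetCell r e f) = {r}"
| "written_arrays (Seq P R) = written_arrays P \<union> written_arrays R"
| "written_arrays (If b P R) = written_arrays P \<union> written_arrays R"
| "written_arrays (While b P) = written_arrays P"
| "written_arrays _ = {}"

definition agree_off :: "nat set \<Rightarrow> nat set \<Rightarrow> store \<Rightarrow> store \<Rightarrow> bool" where
  "agree_off X Y \<sigma> \<tau> \<longleftrightarrow>
     (\<forall>x. x \<notin> X \<longrightarrow> reg \<tau> x = reg \<sigma> x) \<and> (\<forall>r. r \<notin> Y \<longrightarrow> cell \<tau> r = cell \<sigma> r)"

lemma agree_off_refl: "agree_off X Y \<sigma> \<sigma>"
  by (simp add: agree_off_def)

lemma agree_off_trans:
  "agree_off X Y \<sigma> \<tau> \<Longrightarrow> agree_off X' Y' \<tau> \<rho> \<Longrightarrow> X \<subseteq> Z \<Longrightarrow> X' \<subseteq> Z \<Longrightarrow> Y \<subseteq> V \<Longrightarrow> Y' \<subseteq> V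
    \<Longrightarrow> agree_off Z V \<sigma> \<rho>"
  unfolding agree_off_def by (metis subsetD)

lemma agree_offD:
  assumes "agree_off X Y \<sigma> \<tau>"
  shows "x \<notin> X \<Longrightarrow> reg \<tau> x = reg \<sigma> x" and "r \<notin> Y \<Longrightarrow> cell \<tau> r = cell \<sigma> r"
  using assms by (auto simp: agree_off_def)

lemma exec_agree_off:
  "exec w P \<sigma> t \<tau> \<Longrightarrow> agree_off (written_regs P) (written_arrays P) \<sigma> \<tau>"
  by (induction rule: exec.induct) (auto simp: agree_off_def)

lemma runs_SetReg:
  "acost e + 1 \<le> B \<Longrightarrow> Q (\<sigma>\<lparr>reg := (reg \<sigma>)(x := aval w \<sigma> e)\<rparr>) \<Longrightarrow> runs w (SetReg x e) \<sigma> B Q"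
  unfolding runs_def using exec.SetReg by blast

lemma runs_SetCell:
  "acost e + acost f + 1 \<le> B \<Longrightarrow>
   Q (\<sigma>\<lparr>cell := (cell \<sigma>)(r := (cell \<sigma> r)(aval w \<sigma> e := aval w \<sigma> f))\<rparr>) \<Longrightarrow>
   runs w (SetCell r e f) \<sigma> B Q"
  unfolding runs_def using exec.SetCell by blast

lemma runs_Skip: "1 \<le> B \<Longrightarrow> Q \<sigma> \<Longrightarrow> runs w Skip \<sigma> B Q"
  unfolding runs_def using exec.Skip by blast

lemma runs_Seq:
  assumes "runs w P \<sigma> BP Q'"
    and "\<And>\<tau>. Q' \<tau> \<Longrightarrow> agree_off (written_regs P) (written_arrays P) \<sigma> \<tau> \<Longrightarrow> runs w R \<tau> BR Q"
    and "BP + BR \<le> B"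
  shows "runs w (Seq P R) \<sigma> B Q"
proof -
  from assms(1) obtain t \<tau> where 1: "exec w P \<sigma> t \<tau>" "t \<le> BP" "Q' \<tau>" by (auto simp: runs_def)
  from assms(2)[OF 1(3) exec_agree_off[OF 1(1)]] obtain t' \<tau>' where
    2: "exec w R \<tau> t' \<tau>'" "t' \<le> BR" "Q \<tau>'" by (auto simp: runs_def)
  have "exec w (Seq P R) \<sigma> (t + t') \<tau>'" by (rule exec.Seq[OF 1(1) 2(1)])
  moreover have "t + t' \<le> B" using 1 2 assms(3) by linarith
  ultimately show ?thesis using 2(3) unfolding runs_def by blast
qed

lemma runs_If:
  assumes "bval w \<sigma> b \<Longrightarrow> runs w P \<sigma> B' Q" and "\<not> bval w \<sigma> b \<Longrightarrow> runs w R \<sigma> B' Q"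
    and "bcost b + B' + 1 \<le> B"
  shows "runs w (If b P R) \<sigma> B Q"
proof (cases "bval w \<sigma> b")
  case True
  with assms(1) obtain t \<tau> where 1: "exec w P \<sigma> t \<tau>" "t \<le> B'" "Q \<tau>" by (auto simp: runs_def)
  with assms(3) exec.IfTrue[OF True 1(1), of R] show ?thesis
    unfolding runs_def by (intro exI[of _ "bcost b + t + 1"] exI[of _ \<tau>]) auto
next
  case False
  with assms(2) obtain t \<tau> where 1: "exec w R \<sigma> t \<tau>" "t \<le> B'" "Q \<tau>" by (auto simp: runs_def)
  with assms(3) exec.IfFalse[OF False 1(1), of P] show ?thesis
    unfolding runs_def by (intro exI[of _ "bcost b + t + 1"] exI[of _ \<tau>]) auto
qed

lemma runs_mono: "runs w P \<sigma> B Q \<Longrightarrow> B \<le> B' \<Longrightarrow> (\<And>\<tau>. Q \<tau> \<Longrightarrow> Q' \<tau>) \<Longrightarrow> runs w P \<sigma> B' Q'"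
  unfolding runs_def by fastforce

lemma runs_agree_off:
  "runs w P \<sigma> B Q \<Longrightarrow>
   runs w P \<sigma> B (\<lambda>\<tau>. Q \<tau> \<and> agree_off (written_regs P) (written_arrays P) \<sigma> \<tau>)"
  unfolding runs_def using exec_agree_off by blast

lemma runs_While:
  assumes step: "\<And>k \<tau>. I k \<tau> \<Longrightarrow> bval w \<tau> b \<Longrightarrow>
      agree_off (written_regs P) (written_arrays P) \<sigma> \<tau> \<Longrightarrow> k < N \<and> runs w P \<tau> B (I (Suc k))"
    and "I 0 \<sigma>"
  shows "runs w (While b P) \<sigma> (N * (B + bcost b + 1) + bcost b + 1)
    (\<lambda>\<tau>. \<not> bval w \<tau> b \<and> (\<exists>k. I k \<tau>))"
proof -
  have "runs w (While b P) \<tau> ((N - k) * (B + bcost b + 1) + bcost b + 1)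
    (\<lambda>\<tau>. \<not> bval w \<tau> b \<and> (\<exists>k. I k \<tau>))"
    if "I k \<tau>" "agree_off (written_regs P) (written_arrays P) \<sigma> \<tau>" for k \<tau>
    using that
  proof (induction "N - k" arbitrary: k \<tau> rule: less_induct)
    case less
    show ?case
    proof (cases "bval w \<tau> b")
      case False
      then show ?thesis using exec.WhileFalse[OF False, of P] less.prems
        unfolding runs_def by fastforce
    next
      case True
      from step[OF less.prems(1) True less.prems(2)] have k: "k < N" and "runs w P \<tau> B (I (Suc k))"
        by auto
      then obtain t \<rho> where 1: "exec w P \<tau> t \<rho>" "t \<le> B" "I (Suc k) \<rho>" by (auto simp: runs_def)
      have "agree_off (written_regs P) (written_arrays P) \<sigma> \<rho>"
        by (rule agree_off_trans[OF less.prems(2) exec_agree_off[OF 1(1)]]) auto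
      with less.hyps[of "Suc k" \<rho>] k 1(3) obtain t' \<rho>' where
        2: "exec w (While b P) \<rho> t' \<rho>'" "t' \<le> (N - Suc k) * (B + bcost b + 1) + bcost b + 1"
           "\<not> bval w \<rho>' b \<and> (\<exists>k. I k \<rho>')"
        unfolding runs_def by (metis diff_less_mono2 lessI)
      have "N - k = Suc (N - Suc k)" using k by simp
      then have "bcost b + t + t' + 1 \<le> (N - k) * (B + bcost b + 1) + bcost b + 1"
        using 1 2 by simp
      with exec.WhileTrue[OF True 1(1) 2(1)] 2(3) show ?thesis unfolding runs_def by blast
    qed
  qed
  from this[of 0 \<sigma>] assms(2) agree_off_refl show ?thesis by simp
qed

definition For :: "nat \<Rightarrow> aexp \<Rightarrow> com \<Rightarrow> com" where
  "For x e P = Seq (SetReg x (Lit 0))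
     (While (Less (Reg x) e) (Seq P (SetReg x (Add (Reg x) (Lit 1)))))"

definition for_cost :: "nat \<Rightarrow> nat \<Rightarrow> nat \<Rightarrow> nat" where
  "for_cost N c B = N * (B + c + 7) + c + 5"

lemma written_For [simp]:
  "written_regs (For x e P) = insert x (written_regs P)"
  "written_arrays (For x e P) = written_arrays P"
  by (auto simp: For_def)

lemma runs_For:
  assumes x: "x \<notin> written_regs P"
    and e: "\<And>\<tau>. agree_off (insert x (written_regs P)) (written_arrays P) \<sigma> \<tau> \<Longrightarrow> aval w \<tau> e = N"
    and N: "N < 2 ^ w"
    and I0: "I 0 (\<sigma>\<lparr>reg := (reg \<sigma>)(x := 0)\<rparr>)"
    and step: "\<And>i \<tau>. i < N \<Longrightarrow> I i \<tau> \<Longrightarrow> reg \<tau> x = i \<Longrightarrow>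
      agree_off (insert x (written_regs P)) (written_arrays P) \<sigma> \<tau> \<Longrightarrow>
      runs w P \<tau> B (\<lambda>\<tau>'. I (Suc i) (\<tau>'\<lparr>reg := (reg \<tau>')(x := Suc i)\<rparr>))"
    and Q: "\<And>\<tau>. I N \<tau> \<Longrightarrow> agree_off (insert x (written_regs P)) (written_arrays P) \<sigma> \<tau> \<Longrightarrow> Q \<tau>"
    and B': "for_cost N (acost e) B \<le> B'"
  shows "runs w (For x e P) \<sigma> B' Q"
proof -
  let ?W = "Seq P (SetReg x (Add (Reg x) (Lit 1)))"
  define \<sigma>0 where "\<sigma>0 = \<sigma>\<lparr>reg := (reg \<sigma>)(x := 0)\<rparr>"
  let ?J = "\<lambda>k \<tau>. k \<le> N \<and> I k \<tau> \<and> reg \<tau> x = k"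
  have off: "agree_off (insert x (written_regs P)) (written_arrays P) \<sigma> \<tau>"
    if "agree_off (written_regs ?W) (written_arrays ?W) \<sigma>0 \<tau>" for \<tau>
    using that by (auto simp: agree_off_def \<sigma>0_def)
  have "runs w (While (Less (Reg x) e) ?W) \<sigma>0
    (N * ((B + 4) + bcost (Less (Reg x) e) + 1) + bcost (Less (Reg x) e) + 1)
    (\<lambda>\<tau>. \<not> bval w \<tau> (Less (Reg x) e) \<and> (\<exists>k. ?J k \<tau>))"
  proof (rule runs_While, goal_cases)
    case (1 k \<tau>)
    note o = off[OF 1(3)]
    from 1 e[OF o] have k: "k < N" and xk: "reg \<tau> x = k" and I: "I k \<tau>" by auto
    have "runs w ?W \<tau> (B + 4) (?J (Suc k))"
    proof (rule runs_Seq)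
      show "runs w P \<tau> B (\<lambda>\<tau>'. I (Suc k) (\<tau>'\<lparr>reg := (reg \<tau>')(x := Suc k)\<rparr>))"
        by (rule step[OF k I xk o])
      fix \<tau>' assume I': "I (Suc k) (\<tau>'\<lparr>reg := (reg \<tau>')(x := Suc k)\<rparr>)"
        and "agree_off (written_regs P) (written_arrays P) \<tau> \<tau>'"
      then have "reg \<tau>' x = k" using x xk by (simp add: agree_off_def)
      moreover have "0 < w" "Suc k < 2 ^ w" using k N by (cases w; simp)+
      ultimately show "runs w (SetReg x (Add (Reg x) (Lit 1))) \<tau>' 4 (?J (Suc k))"
        using I' k by (intro runs_SetReg) auto
    qed simp
    with k show ?case by simp
  next
    case 2
    show ?case using I0 by (simp add: \<sigma>0_def)
  qed
  then have W: "runs w (While (Less (Reg x) e) ?W) \<sigma>0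
      (N * ((B + 4) + bcost (Less (Reg x) e) + 1) + bcost (Less (Reg x) e) + 1) Q"
  proof (rule runs_mono[OF runs_agree_off], goal_cases)
    case (2 \<tau>)
    then have o: "agree_off (insert x (written_regs P)) (written_arrays P) \<sigma> \<tau>"
      by (intro off) simp
    with 2 e[OF o] have "I N \<tau>" by auto
    then show ?case using o by (rule Q)
  qed simp
  have "2 + (N * ((B + 4) + bcost (Less (Reg x) e) + 1) + bcost (Less (Reg x) e) + 1) = for_cost N (acost e) B"
    by (simp add: for_cost_def algebra_simps)
  then show ?thesis unfolding For_def
    by (intro runs_Seq[where BP = 2 and Q' = "\<lambda>\<tau>. \<tau> = \<sigma>0", OF runs_SetReg])
      (use W B' in \<open>auto simp: \<sigma>0_def\<close>)
qed

lemma runs_map_loop: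
  assumes e: "\<And>\<tau>. agree_off {x} {r} \<sigma> \<tau> \<Longrightarrow> aval w \<tau> e = N"
    and N: "N < 2 ^ w"
    and f: "\<And>i \<tau>. i < N \<Longrightarrow> agree_off {x} {r} \<sigma> \<tau> \<Longrightarrow> reg \<tau> x = i \<Longrightarrow> aval w \<tau> f = g i"
    and Q: "\<And>\<tau>. agree_off {x} {r} \<sigma> \<tau> \<Longrightarrow>
      (\<And>i. cell \<tau> r i = (if i < N then g i else cell \<sigma> r i)) \<Longrightarrow> Q \<tau>"
    and B: "for_cost N (acost e) (acost f + 2) \<le> B"
  shows "runs w (For x e (SetCell r (Reg x) f)) \<sigma> B Q"
proof (rule runs_For[where N = N and B = "acost f + 2" and
    I = "\<lambda>i \<tau>. \<forall>j. cell \<tau> r j = (if j < i then g j else cell \<sigma> r j)"], goal_cases)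
  case (5 i \<tau>)
  then have "aval w \<tau> f = g i" using f by simp
  with 5 show ?case by (intro runs_SetCell) (simp_all add: less_Suc_eq)
next
  case (6 \<tau>)
  then show ?case using Q[of \<tau>] by simp
qed (use e N B in simp_all)

definition Count :: "nat \<Rightarrow> nat \<Rightarrow> aexp \<Rightarrow> bexp \<Rightarrow> com" where
  "Count c x e b = For x e (If b (SetReg c (Add (Reg c) (Lit 1))) Skip)"

lemma written_Count [simp]:
  "written_regs (Count c x e b) = {x, c}" "written_arrays (Count c x e b) = {}"
  by (auto simp: Count_def)

lemma runs_Count:
  assumes e: "\<And>\<tau>. agree_off {x, c} {} \<sigma> \<tau> \<Longrightarrow> aval w \<tau> e = N"
    and N: "reg \<sigma> c + N < 2 ^ w" and xc: "x \<noteq> c"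
    and b: "\<And>i \<tau>. i < N \<Longrightarrow> agree_off {x, c} {} \<sigma> \<tau> \<Longrightarrow> reg \<tau> x = i \<Longrightarrow> bval w \<tau> b = p i"
    and Q: "\<And>\<tau>. agree_off {x, c} {} \<sigma> \<tau> \<Longrightarrow> reg \<tau> c = reg \<sigma> c + card {i. i < N \<and> p i} \<Longrightarrow> Q \<tau>"
    and B: "for_cost N (acost e) (bcost b + 5) \<le> B"
  shows "runs w (Count c x e b) \<sigma> B Q"
  unfolding Count_def
proof (rule runs_For[where N = N and B = "bcost b + 5" and
    I = "\<lambda>i \<tau>. reg \<tau> c = reg \<sigma> c + card {j. j < i \<and> p j}"], goal_cases)
  case (5 i \<tau>)
  then have bp: "bval w \<tau> b = p i" using b by simp
  have le: "card {j. j < i \<and> p j} \<le> i" using card_mono[of "{..<i}" "{j. j < i \<and> p j}"] by auto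
  have S: "{j. j < Suc i \<and> p j} = (if p i then insert i {j. j < i \<and> p j} else {j. j < i \<and> p j})"
    by (auto simp: less_Suc_eq)
  have w: "0 < w" "Suc (reg \<sigma> c + card {j. j < i \<and> p j}) < 2 ^ w"
    using N le 5(1) by (cases w; simp)+
  show ?case
    by (rule runs_If[where B' = 4]; (rule runs_SetReg runs_Skip)?)
      (use 5(2) xc bp S w in \<open>simp_all add: add.assoc\<close>)
next
  case (6 \<tau>)
  then show ?case using Q[of \<tau>] by simp
qed (use e N B xc in simp_all)

definition Argmin :: "nat \<Rightarrow> nat \<Rightarrow> nat \<Rightarrow> aexp \<Rightarrow> bexp \<Rightarrow> aexp \<Rightarrow> com" where
  "Argmin m a x e b f = For x e (If (Conj b (Less f (Reg m)))
     (Seq (SetReg m f) (SetReg a (Reg x))) Skip)"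

lemma written_Argmin [simp]:
  "written_regs (Argmin m a x e b f) = {x, m, a}" "written_arrays (Argmin m a x e b f) = {}"
  by (auto simp: Argmin_def)

lemma runs_Argmin:
  assumes e: "\<And>\<tau>. agree_off {x, m, a} {} \<sigma> \<tau> \<Longrightarrow> aval w \<tau> e = N"
    and N: "N < 2 ^ w" and regs: "x \<noteq> m" "x \<noteq> a" "m \<noteq> a"
    and b: "\<And>i \<tau>. i < N \<Longrightarrow> agree_off {x, m, a} {} \<sigma> \<tau> \<Longrightarrow> reg \<tau> x = i \<Longrightarrow> bval w \<tau> b = p i"
    and f: "\<And>i \<tau>. i < N \<Longrightarrow> agree_off {x, m, a} {} \<sigma> \<tau> \<Longrightarrow> reg \<tau> x = i \<Longrightarrow> aval w \<tau> f = g i"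
    and top: "\<And>i. i < N \<Longrightarrow> p i \<Longrightarrow> g i < reg \<sigma> m" and ex: "\<exists>i<N. p i"
    and Q: "\<And>\<tau>. agree_off {x, m, a} {} \<sigma> \<tau> \<Longrightarrow> reg \<tau> a < N \<Longrightarrow> p (reg \<tau> a) \<Longrightarrow>
      (\<And>j. j < N \<Longrightarrow> p j \<Longrightarrow> g (reg \<tau> a) \<le> g j) \<Longrightarrow> Q \<tau>"
    and B: "for_cost N (acost e) (bcost b + 2 * acost f + 7) \<le> B"
  shows "runs w (Argmin m a x e b f) \<sigma> B Q"
  unfolding Argmin_def
proof (rule runs_For[where N = N and B = "bcost b + 2 * acost f + 7" and
    I = "\<lambda>i \<tau>. (\<forall>j<i. p j \<longrightarrow> reg \<tau> m \<le> g j) \<and>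
      (reg \<tau> m = reg \<sigma> m \<or> reg \<tau> a < i \<and> p (reg \<tau> a) \<and> reg \<tau> m = g (reg \<tau> a))"], goal_cases)
  case (5 i \<tau>)
  then have off: "agree_off {x, m, a} {} \<sigma> \<tau>" by (simp add: insert_commute)
  have bp: "bval w \<tau> b = p i" "aval w \<tau> f = g i" using b f 5 off by auto
  show ?case
  proof (rule runs_If[where B' = "acost f + 3"], goal_cases)
    case 1
    show ?case
      by (rule runs_Seq[where BP = "acost f + 1" and BR = 2 and
          Q' = "\<lambda>\<rho>. \<rho> = \<tau>\<lparr>reg := (reg \<tau>)(m := g i)\<rparr>"])
        (use 1 5 regs bp in \<open>auto intro!: runs_SetReg simp: less_Suc_eq\<close>)
  next
    case 2
    then show ?case using 5 regs bp by (intro runs_Skip) (auto simp: less_Suc_eq)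
  qed simp
next
  case (6 \<tau>)
  then have off: "agree_off {x, m, a} {} \<sigma> \<tau>" by (simp add: insert_commute)
  from ex obtain i where i: "i < N" "p i" by auto
  then have "reg \<tau> m \<noteq> reg \<sigma> m" using 6(1) top[OF i] by force
  with 6(1) off show ?case by (intro Q) auto
qed (use e N B regs in \<open>simp_all add: insert_commute\<close>)

notation Seq (infixr \<open>;;\<close> 60)

definition Rank :: "nat \<Rightarrow> nat \<Rightarrow> nat \<Rightarrow> nat \<Rightarrow> aexp \<Rightarrow> nat \<Rightarrow> bexp \<Rightarrow> com" where
  "Rank r i c j e k b = For i e (SetReg c (Lit k) ;; Count c j e b ;; SetCell r (Reg i) (Reg c))"

lemma written_Rank [simp]:
  "written_regs (Rank r i c j e k b) = {i, c, j}" "written_arrays (Rank r i c j e k b) = {r}"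
  by (auto simp: Rank_def)

lemma runs_Rank:
  assumes e: "\<And>\<tau>. agree_off {i, c, j} {r} \<sigma> \<tau> \<Longrightarrow> aval w \<tau> e = N"
    and N: "k + N < 2 ^ w" and regs: "i \<noteq> c" "i \<noteq> j" "c \<noteq> j"
    and b: "\<And>x y \<tau>. x < N \<Longrightarrow> y < N \<Longrightarrow> agree_off {i, c, j} {r} \<sigma> \<tau> \<Longrightarrow> reg \<tau> i = x \<Longrightarrow> reg \<tau> j = y
      \<Longrightarrow> bval w \<tau> b = p x y"
    and Q: "\<And>\<tau>. agree_off {i, c, j} {r} \<sigma> \<tau> \<Longrightarrow>
      (\<And>x. x < N \<Longrightarrow> cell \<tau> r x = k + card {y. y < N \<and> p x y}) \<Longrightarrow> Q \<tau>"
    and B: "for_cost N (acost e) (for_cost N (acost e) (bcost b + 5) + 5) \<le> B"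
  shows "runs w (Rank r i c j e k b) \<sigma> B Q"
  unfolding Rank_def
proof (rule runs_For[where N = N and B = "for_cost N (acost e) (bcost b + 5) + 5" and
    I = "\<lambda>x \<tau>. \<forall>y<x. cell \<tau> r y = k + card {z. z < N \<and> p y z}"], goal_cases)
  case (5 x \<tau>)
  then have off: "agree_off {i, c, j} {r} \<sigma> \<tau>" by (simp add: insert_commute)
  have k: "k < 2 ^ w" using N by simp
  show ?case
  proof (rule runs_Seq[where BP = 2 and BR = "for_cost N (acost e) (bcost b + 5) + 3" and
      Q' = "\<lambda>\<rho>. \<rho> = \<tau>\<lparr>reg := (reg \<tau>)(c := k)\<rparr>"], goal_cases)
    case 1
    show ?case using k by (intro runs_SetReg) auto
  next
    case (2 \<tau>')
    have trans: "agree_off {i, c, j} {r} \<sigma> \<rho>" "reg \<rho> i = x" if "agree_off {j, c} {} \<tau>' \<rho>" for \<rho>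
      using off that 2 5(3) regs by (auto simp: agree_off_def)
    show ?case
    proof (rule runs_Seq[where BP = "for_cost N (acost e) (bcost b + 5)" and BR = 3 and
        Q' = "\<lambda>\<rho>. reg \<rho> c = k + card {z. z < N \<and> p x z}"], goal_cases)
      case 1
      show ?case
        by (rule runs_Count[where N = N and p = "p x"])
          (use e trans b 5(1) regs N 2(1) in auto)
    next
      case (2 \<rho>)
      then have "reg \<rho> i = x" using trans by simp
      moreover have "cell \<rho> = cell \<tau>" using 2(2) \<open>\<tau>' = _\<close> by (auto simp: agree_off_def)
      ultimately show ?case using 2(1) 5(2) by (intro runs_SetCell) (auto simp: less_Suc_eq)
    qed simp
  qed simp
next
  case (6 \<tau>)
  then show ?case using Q[of \<tau>] by (simp add: insert_commute)
qed (use e N B regs in \<open>simp_all add: insert_commute\<close>)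

lemma for_cost_mono: "N \<le> N' \<Longrightarrow> c \<le> c' \<Longrightarrow> B \<le> B' \<Longrightarrow> for_cost N c B \<le> for_cost N' c' B'"
  unfolding for_cost_def by (intro add_mono mult_mono) auto

section \<open>The program\<close>

text \<open>
  Registers: \<open>8\<close>, \<open>9\<close> and \<open>11\<close> contain \<open>2 * n\<close>, \<open>n + 1\<close> and \<open>2 * n + 1\<close>, and \<open>7\<close> the current
  word length. Nodes \<open>i < n\<close> stand for the smallest word into state \<open>i\<close>, nodes \<open>n + i\<close> for the
  largest one. Arrays: \<open>5\<close> letter codes of the states, \<open>14\<close> their ranks, \<open>13\<close> transitions by
  letter rank, \<open>6\<close> ranks of the nodes, \<open>7\<close> their transition tables (the state number \<open>n\<close> is a
  sink), \<open>10\<close> the node whose word extends that of a node, \<open>11\<close> sorting keys, \<open>12\<close> the right ends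
  of the chains.
\<close>

definition prepare :: com where
  "prepare = SetReg 8 (Add (Reg 0) (Reg 0)) ;; SetReg 9 (Add (Reg 0) (Lit 1)) ;;
     SetReg 11 (Add (Reg 8) (Lit 1))"

definition load_labels :: com where
  "load_labels = For 3 (Reg 1) (SetCell 5 (Cell 2 (Reg 3)) (Cell 1 (Reg 3)))"

definition rank_labels :: com where
  "rank_labels = Rank 14 3 5 4 (Reg 0) 1
     (Conj (Neg (Equal (Reg 4) (Reg 2))) (Less (Cell 5 (Reg 4)) (Cell 5 (Reg 3)))) ;;
   SetCell 14 (Reg 2) (Lit 0)"

definition load_ranks :: com where
  "load_ranks = For 3 (Reg 8) (SetCell 6 (Reg 3) (Cell 14 (Rem (Reg 3) (Reg 0))))"

definition load_letters :: com where
  "load_letters = For 3 (Mul (Reg 9) (Reg 9)) (SetCell 13 (Reg 3) (Reg 0)) ;;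
   For 3 (Reg 1) (SetCell 13 (Add (Mul (Cell 14 (Cell 2 (Reg 3))) (Reg 9)) (Cell 0 (Reg 3)))
     (Cell 2 (Reg 3))) ;;
   SetCell 13 (Reg 2) (Reg 2)"

definition load_table :: com where
  "load_table = For 3 (Mul (Reg 8) (Reg 9)) (SetCell 7 (Reg 3)
     (Cell 13 (Add (Mul (Cell 6 (Quot (Reg 3) (Reg 9))) (Reg 9)) (Rem (Reg 3) (Reg 9)))))"

definition candidate :: bexp where
  "candidate = Equal (Cell 7 (Add (Mul (Reg 3) (Reg 9)) (Reg 4))) (Rem (Reg 3) (Reg 0))"

definition select_nodes :: com where
  "select_nodes = For 3 (Reg 8) (SetReg 5 (Reg 11) ;;
     If (Less (Reg 3) (Reg 0)) (Argmin 5 6 4 (Reg 0) candidate (Cell 6 (Reg 4)))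
       (Argmin 5 6 4 (Reg 0) candidate (Sub (Reg 8) (Cell 6 (Add (Reg 0) (Reg 4))))) ;;
     SetCell 10 (Reg 3) (Add (Sub (Reg 3) (Rem (Reg 3) (Reg 0))) (Reg 6)))"

definition compose :: com where
  "compose = For 3 (Mul (Reg 8) (Reg 9)) (SetCell 8 (Reg 3)
     (Cell 7 (Add (Mul (Quot (Reg 3) (Reg 9)) (Reg 9))
       (Cell 7 (Add (Mul (Cell 10 (Quot (Reg 3) (Reg 9))) (Reg 9)) (Rem (Reg 3) (Reg 9))))))) ;;
   For 3 (Mul (Reg 8) (Reg 9)) (SetCell 7 (Reg 3) (Cell 8 (Reg 3)))"

definition rerank :: com where
  "rerank = For 3 (Reg 8) (SetCell 11 (Reg 3)
     (Add (Mul (Cell 6 (Reg 3)) (Reg 11)) (Cell 6 (Cell 10 (Reg 3))))) ;;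
   Rank 6 3 5 4 (Reg 8) 0 (Less (Cell 11 (Reg 4)) (Cell 11 (Reg 3)))"

definition double :: com where
  "double = select_nodes ;; compose ;; rerank"

definition double_cost :: "nat \<Rightarrow> nat" where
  "double_cost k = for_cost (2 * k) 1 (for_cost k 1 29 + 15) +
     (for_cost (2 * k * (k + 1)) 3 20 + for_cost (2 * k * (k + 1)) 3 4) +
     (for_cost (2 * k) 1 10 + for_cost (2 * k) 1 (for_cost (2 * k) 1 10 + 5))"

definition iterate :: com where
  "iterate = SetReg 7 (Lit 1) ;;
     While (Less (Reg 7) (Reg 8)) (double ;; SetReg 7 (Add (Reg 7) (Reg 7)))"

definition first_fit :: com where
  "first_fit = SetReg 5 (Mul (Reg 11) (Reg 11)) ;;
     Argmin 5 6 4 (Reg 0) (Equal (Cell 4 (Reg 4)) (Lit 0)) (Cell 11 (Reg 4)) ;;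
     SetReg 10 (Lit 0) ;;
     While (Less (Cell 6 (Reg 6)) (Cell 12 (Reg 10))) (SetReg 10 (Add (Reg 10) (Lit 1))) ;;
     SetCell 12 (Reg 10) (Cell 6 (Add (Reg 0) (Reg 6))) ;;
     SetCell 4 (Reg 6) (Add (Reg 10) (Lit 1))"

definition color :: com where
  "color = For 3 (Reg 0) (SetCell 11 (Reg 3)
     (Add (Mul (Cell 6 (Reg 3)) (Reg 11)) (Cell 6 (Add (Reg 0) (Reg 3))))) ;;
   For 3 (Reg 0) first_fit"

definition program :: com where
  "program = prepare ;; load_labels ;; rank_labels ;; load_ranks ;; load_letters ;; load_table ;;
     iterate ;; color"

definition program_cost :: "nat \<Rightarrow> nat \<Rightarrow> nat" where
  "program_cost k M = 12 + (for_cost (k ^ 2) 1 5 + ((for_cost k 1 (for_cost k 1 16 + 5) + 3) +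
     (for_cost (2 * k) 1 6 + ((for_cost ((k + 1) * (k + 1)) 3 3 + for_cost (k ^ 2) 1 13 + 3) +
     (for_cost (2 * k * (k + 1)) 3 13 + ((M * (double_cost k + 8) + 6) +
     (for_cost k 1 11 + for_cost k 1 (for_cost k 1 15 + (10 * k + 23)))))))))"

section \<open>Extremal words of a padded automaton\<close>

lemma append_less_append_iff:
  "length xs = length ys \<Longrightarrow> xs @ xs' < ys @ ys' \<longleftrightarrow> xs < ys \<or> xs = ys \<and> xs' < ys'"
  for xs ys :: "'b::linorder list"
  by (induction xs ys rule: list_induct2) auto

lemma append_le_append_iff:
  "length xs = length ys \<Longrightarrow> xs @ xs' \<le> ys @ ys' \<longleftrightarrow> xs < ys \<or> xs = ys \<and> xs' \<le> ys'"
  for xs ys :: "'b::linorder list"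
  by (induction xs ys rule: list_induct2) auto

lemma take_pad_mono:
  fixes \<alpha> \<beta> :: "nat list"
  assumes "\<alpha> < \<beta>" "0 \<notin> set \<beta>" "N \<le> length \<alpha> + k" "N \<le> length \<beta> + l"
  shows "take N (\<alpha> @ replicate k 0) \<le> take N (\<beta> @ replicate l 0)"
  using assms
proof (induction N arbitrary: \<alpha> \<beta> k l)
  case (Suc N)
  from Suc.prems(1) obtain b \<beta>' where \<beta>: "\<beta> = b # \<beta>'" by (cases \<beta>) auto
  show ?case
  proof (cases \<alpha>)
    case Nil
    then show ?thesis using Suc.prems \<beta> by (cases k) auto
  next
    case (Cons a \<alpha>')
    then show ?thesis using Suc.prems Suc.IH[of \<alpha>' \<beta>' k l] \<beta> by auto
  qed
qed simp

lemma pad_inject: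
  fixes \<alpha> \<beta> :: "nat list"
  assumes "\<alpha> @ replicate k 0 = \<beta> @ replicate l 0" "0 \<notin> set \<alpha>" "0 \<notin> set \<beta>"
  shows "\<alpha> = \<beta>"
proof -
  have "filter (\<lambda>c. c \<noteq> 0) (\<alpha> @ replicate k 0) = \<alpha>" "filter (\<lambda>c. c \<noteq> 0) (\<beta> @ replicate l 0) = \<beta>"
    using assms(2,3) by (auto intro!: filter_True intro: gr0I)
  with assms(1) show ?thesis by metis
qed

text \<open>Words are lists with the letter read last in front, so that the co-lexicographic order
  becomes the lexicographic order of lists.\<close>

fun dw :: "(nat \<Rightarrow> nat \<Rightarrow> nat) \<Rightarrow> nat list \<Rightarrow> nat \<Rightarrow> nat" where
  "dw d [] v = v"
| "dw d (c # x) v = d c (dw d x v)"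

lemma dw_append: "dw d (x @ y) v = dw d x (dw d y v)"
  by (induction x) auto

text \<open>A complete automaton on \<open>{..<n}\<close> with sink \<open>n\<close>. The additional letter \<open>0\<close> only labels a
  loop at the initial state, which pads all words to the same length.\<close>

locale padded_dfa =
  fixes n s :: nat and lab :: "nat \<Rightarrow> nat" and d :: "nat \<Rightarrow> nat \<Rightarrow> nat"
  assumes s_less: "s < n"
    and lab_s: "lab s = 0"
    and d_le: "d c v \<le> n"
    and d_sink: "n \<le> v \<Longrightarrow> d c v = n"
    and d_lab: "d c v < n \<Longrightarrow> lab (d c v) = c"
    and d_0: "d 0 v = (if v = s then s else n)"
    and reachable: "u < n \<Longrightarrow> \<exists>x. 0 \<notin> set x \<and> dw d x s = u"
begin

definition R :: "nat \<Rightarrow> nat list set" where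
  "R u = {x. 0 \<notin> set x \<and> dw d x s = u}"

definition W :: "nat \<Rightarrow> nat \<Rightarrow> nat list set" where
  "W L u = {x. length x = L \<and> (\<exists>v<n. dw d x v = u)}"

definition lo :: "nat \<Rightarrow> nat \<Rightarrow> nat list" where "lo L u = Min (W L u)"

definition hi :: "nat \<Rightarrow> nat \<Rightarrow> nat list" where "hi L u = Max (W L u)"

definition word :: "nat \<Rightarrow> nat \<Rightarrow> nat list" where
  "word L i = (if i < n then lo L i else hi L (i - n))"

lemma dw_sink: "n \<le> v \<Longrightarrow> dw d x v \<ge> n"
  by (induction x) (auto simp: d_sink)

lemma dw_le: "v \<le> n \<Longrightarrow> dw d x v \<le> n"
  by (cases x) (auto simp: d_le)

lemma set_word: "dw d x v < n \<Longrightarrow> set x \<subseteq> lab ` {..<n}"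
proof (induction x)
  case (Cons c x)
  then have "dw d x v < n" using d_sink[of "dw d x v" c] by (metis dw.simps(2) less_irrefl not_le)
  with Cons d_lab[of c "dw d x v"] show ?case
    by simp (metis imageI lessThan_iff)
qed simp

lemma finite_W: "u < n \<Longrightarrow> finite (W L u)"
  by (rule finite_subset[OF _ finite_lists_length_eq[of "lab ` {..<n}" L]])
    (auto simp: W_def dest: set_word)

lemma dw_zeros: "dw d (replicate k 0) s = s"
  by (induction k) (auto simp: d_0)

lemma R_s: "x \<in> R s \<Longrightarrow> x = []"
  using s_less lab_s d_lab[of "hd x" "dw d (tl x) s"] by (cases x) (auto simp: R_def)

lemma strip_padding: "dw d x s = u \<Longrightarrow> u < n \<Longrightarrow> \<exists>\<alpha> k. \<alpha> \<in> R u \<and> x = \<alpha> @ replicate k 0"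
proof (induction x arbitrary: u)
  case Nil
  have "[] \<in> R s" by (simp add: R_def)
  with Nil.prems(1) show ?case by (metis append_Nil dw.simps(1) replicate_0)
next
  case (Cons c x)
  define p where "p = dw d x s"
  have "d c p = u" using Cons.prems by (simp add: p_def)
  moreover from this have "p < n" using Cons.prems(2) d_sink[of p c] by (cases "p < n") auto
  ultimately have p: "p < n" "d c p = u" by auto
  with Cons.IH[of p] p_def obtain \<alpha> k where \<alpha>: "\<alpha> \<in> R p" "x = \<alpha> @ replicate k 0" by auto
  show ?case
  proof (cases "c = 0")
    case True
    with p Cons.prems(2) have "p = s" "u = s" by (auto simp: d_0 split: if_splits)
    with \<alpha> R_s have "\<alpha> = []" by auto
    with \<alpha> \<open>u = s\<close> \<open>p = s\<close> True show ?thesis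
      by (intro exI[of _ "[]"] exI[of _ "Suc k"]) auto
  next
    case False
    with \<alpha> p show ?thesis by (intro exI[of _ "c # \<alpha>"] exI[of _ k]) (auto simp: R_def)
  qed
qed

lemma pad_in_W: "\<alpha> \<in> R u \<Longrightarrow> length \<alpha> \<le> L \<Longrightarrow> \<alpha> @ replicate (L - length \<alpha>) 0 \<in> W L u"
  using s_less by (auto simp: R_def W_def dw_append dw_zeros intro!: exI[of _ s])

lemma W_nonempty: "u < n \<Longrightarrow> W L u \<noteq> {}"
proof -
  assume u: "u < n"
  then obtain \<alpha> where \<alpha>: "\<alpha> \<in> R u" using reachable by (auto simp: R_def)
  let ?x = "\<alpha> @ replicate L 0"
  have x: "dw d ?x s = u" using \<alpha> by (simp add: R_def dw_append dw_zeros)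
  have "dw d (take L ?x) (dw d (drop L ?x) s) = u" using x by (metis append_take_drop_id dw_append)
  moreover from this have "dw d (drop L ?x) s < n" using u dw_sink by (metis not_le)
  ultimately have "take L ?x \<in> W L u" unfolding W_def by auto
  then show ?thesis by auto
qed

lemma lo_W: "u < n \<Longrightarrow> lo L u \<in> W L u" and lo_le: "u < n \<Longrightarrow> x \<in> W L u \<Longrightarrow> lo L u \<le> x"
  and hi_W: "u < n \<Longrightarrow> hi L u \<in> W L u" and hi_ge: "u < n \<Longrightarrow> x \<in> W L u \<Longrightarrow> x \<le> hi L u"
  by (auto simp: lo_def hi_def finite_W W_nonempty)

lemma W_append:
  assumes "u < n" "x \<in> W (L + M) u"
  obtains y z v where "x = y @ z" "y \<in> W L u" "z \<in> W M v" "v < n" "dw d y v = u"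
proof -
  from assms(2) obtain p where p: "p < n" "dw d x p = u" "length x = L + M" by (auto simp: W_def)
  define v where "v = dw d (drop L x) p"
  have y: "dw d (take L x) v = u" using p by (metis append_take_drop_id dw_append v_def)
  then have v: "v < n" using assms(1) dw_sink by (metis not_le)
  show thesis
    by (rule that[of "take L x" "drop L x" v]) (use p y v in \<open>auto simp: W_def v_def\<close>)
qed

lemma append_in_W: "y \<in> W L u \<Longrightarrow> z \<in> W M v \<Longrightarrow> dw d y v = u \<Longrightarrow> y @ z \<in> W (L + M) u"
  by (auto simp: W_def dw_append)

lemma length_W: "x \<in> W L u \<Longrightarrow> length x = L"
  by (simp add: W_def)

lemma lo_append:
  assumes u: "u < n" and v: "v < n" "dw d (lo L u) v = u"
    and min: "\<And>v'. v' < n \<Longrightarrow> dw d (lo L u) v' = u \<Longrightarrow> lo M v \<le> lo M v'"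
  shows "lo (L + M) u = lo L u @ lo M v"
  unfolding lo_def[of "L + M"]
proof (rule Min_eqI)
  show "finite (W (L + M) u)" using u by (rule finite_W)
  show "lo L u @ lo M v \<in> W (L + M) u" using u v by (metis append_in_W lo_W)
  fix x assume "x \<in> W (L + M) u"
  then obtain y z v' where x: "x = y @ z" "y \<in> W L u" "z \<in> W M v'" "v' < n" "dw d y v' = u"
    using W_append[OF u] by metis
  have "lo L u \<le> y" using u x by (intro lo_le)
  moreover have "lo M v \<le> z" if "y = lo L u"
    using min[of v'] lo_le[of v' z M] x that by fastforce
  moreover have "length (lo L u) = length y" using x lo_W[OF u] length_W by metis
  ultimately show "lo L u @ lo M v \<le> x" using x(1) by (auto simp: append_le_append_iff)
qed

lemma hi_append:
  assumes u: "u < n" and v: "v < n" "dw d (hi L u) v = u"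
    and max: "\<And>v'. v' < n \<Longrightarrow> dw d (hi L u) v' = u \<Longrightarrow> hi M v' \<le> hi M v"
  shows "hi (L + M) u = hi L u @ hi M v"
  unfolding hi_def[of "L + M"]
proof (rule Max_eqI)
  show "finite (W (L + M) u)" using u by (rule finite_W)
  show "hi L u @ hi M v \<in> W (L + M) u" using u v by (metis append_in_W hi_W)
  fix x assume "x \<in> W (L + M) u"
  then obtain y z v' where x: "x = y @ z" "y \<in> W L u" "z \<in> W M v'" "v' < n" "dw d y v' = u"
    using W_append[OF u] by metis
  have "y \<le> hi L u" using u x by (intro hi_ge)
  moreover have "z \<le> hi M v" if "y = hi L u"
    using max[of v'] hi_ge[of v' z M] x that by fastforce
  moreover have "length (hi L u) = length y" using x hi_W[OF u] length_W by metis
  ultimately show "x \<le> hi L u @ hi M v" using x(1) by (auto simp: append_le_append_iff)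
qed

definition optimal :: "nat \<Rightarrow> nat \<Rightarrow> nat \<Rightarrow> nat \<Rightarrow> bool" where
  "optimal L M i v \<longleftrightarrow> v < n \<and> dw d (word L i) v = i mod n \<and>
     (\<forall>v'<n. dw d (word L i) v' = i mod n \<longrightarrow>
       (if i < n then word M v \<le> word M v' else word M (n + v') \<le> word M (n + v)))"

lemma word_append:
  assumes "i < 2 * n" "optimal L M i v"
  shows "word (L + M) i = word L i @ word M (i - i mod n + v)"
proof (cases "i < n")
  case True
  then show ?thesis using assms lo_append[of i v L M] by (auto simp: optimal_def word_def)
next
  case False
  then have "i mod n = i - n" "i - n < n" using assms(1) by (auto simp: mod_if)
  with False show ?thesis
    using assms hi_append[of "i - n" v L M] by (auto simp: optimal_def word_def)
qed

lemma word_in_W: "i < 2 * n \<Longrightarrow> word L i \<in> W L (i mod n)"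
proof -
  assume "i < 2 * n"
  then have "\<not> i < n \<Longrightarrow> i mod n = i - n \<and> i - n < n" by (auto simp: mod_if)
  then show ?thesis using lo_W[of i L] hi_W[of "i - n" L] by (auto simp: word_def)
qed

lemma length_word: "i < 2 * n \<Longrightarrow> length (word L i) = L"
  using word_in_W length_W by blast

lemma optimal_candidate: "i < 2 * n \<Longrightarrow> \<exists>v<n. dw d (word L i) v = i mod n"
  using word_in_W[of i L] by (auto simp: W_def)

lemma optimal_exists:
  assumes "i < 2 * n"
  obtains v where "optimal L M i v"
proof -
  let ?S = "{v. v < n \<and> dw d (word L i) v = i mod n}"
  have S: "finite ?S" "?S \<noteq> {}" using optimal_candidate[OF assms] by auto
  obtain v where v: "v \<in> ?S" "\<And>v'. v' \<in> ?S \<Longrightarrow> word M v \<le> word M v'"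
    using ex_is_arg_min_if_finite[OF S, of "word M"] by (auto simp: is_arg_min_linorder)
  have "Max ((\<lambda>v. word M (n + v)) ` ?S) \<in> (\<lambda>v. word M (n + v)) ` ?S" using S by (intro Max_in) auto
  then obtain v1 where v1: "v1 \<in> ?S" "word M (n + v1) = Max ((\<lambda>v. word M (n + v)) ` ?S)" by auto
  then have v2: "word M (n + v') \<le> word M (n + v1)" if "v' \<in> ?S" for v'
    using that S by (auto intro!: Max_ge)
  show thesis
    by (cases "i < n"; rule that[of "if i < n then v else v1"])
      (use v v1(1) v2 in \<open>auto simp: optimal_def\<close>)
qed

lemma node_less: "i < 2 * n \<Longrightarrow> v < n \<Longrightarrow> i - i mod n + v < 2 * n"
  by (auto simp: mod_if)

lemma take_word: "i < 2 * n \<Longrightarrow> L \<le> M \<Longrightarrow> take L (word M i) = word L i"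
proof -
  assume i: "i < 2 * n" and "L \<le> M"
  obtain v where "optimal L (M - L) i v" by (rule optimal_exists[OF i])
  from word_append[OF i this] \<open>L \<le> M\<close> length_word[OF i, of L] show ?thesis by simp
qed

lemma word_mono:
  assumes "i < 2 * n" "j < 2 * n" "L \<le> M"
  shows "word M i \<le> word M j \<Longrightarrow> word L i \<le> word L j"
    and "word L i < word L j \<Longrightarrow> word M i < word M j"
proof -
  have *: "word M i = word L i @ drop L (word M i)" "word M j = word L j @ drop L (word M j)"
    using take_word assms by (metis append_take_drop_id)+
  have l: "length (word L i) = length (word L j)" using length_word assms by simp
  show "word M i \<le> word M j \<Longrightarrow> word L i \<le> word L j"
    by (metis * l append_le_append_iff le_less)
  show "word L i < word L j \<Longrightarrow> word M i < word M j"
    by (metis * l append_less_append_iff)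
qed

lemma optimal_mono: "optimal L M i v \<Longrightarrow> M' \<le> M \<Longrightarrow> optimal L M' i v"
  unfolding optimal_def by (auto intro: word_mono(1)[where M = M])

definition stable :: "nat \<Rightarrow> bool" where
  "stable L \<longleftrightarrow> (\<forall>i<2*n. \<forall>j<2*n. word L i = word L j \<longrightarrow> word (Suc L) i = word (Suc L) j)"

lemma stable_Suc: "stable L \<Longrightarrow> stable (Suc L)"
proof -
  assume st: "stable L"
  have "word (Suc (Suc L)) i = word (Suc (Suc L)) j"
    if i: "i < 2 * n" and j: "j < 2 * n" and eq: "word (Suc L) i = word (Suc L) j" for i j
  proof -
    obtain v where v: "optimal 1 (Suc L) i v" by (rule optimal_exists[OF i])
    obtain v' where v': "optimal 1 (Suc L) j v'" by (rule optimal_exists[OF j])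
    define k k' where "k = i - i mod n + v" and "k' = j - j mod n + v'"
    have k: "k < 2 * n" "k' < 2 * n" using v v' i j node_less by (auto simp: k_def k'_def optimal_def)
    have "word (1 + L) i = word 1 i @ word L k" "word (1 + L) j = word 1 j @ word L k'"
      using word_append[OF i optimal_mono[OF v, of L]] word_append[OF j optimal_mono[OF v', of L]]
      unfolding k_def k'_def by simp_all
    with eq length_word[OF i, of 1] length_word[OF j, of 1]
    have "word 1 i = word 1 j" "word L k = word L k'" by auto
    with st k have "word (Suc L) k = word (Suc L) k'" unfolding stable_def by blast
    with \<open>word 1 i = word 1 j\<close> word_append[OF i v] word_append[OF j v'] show ?thesis
      by (simp add: k_def k'_def)
  qed
  then show ?thesis unfolding stable_def by blast
qed

text \<open>As long as the words are not stable, every further letter splits one of at most \<open>2 * n\<close>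
  classes of equal words.\<close>

lemma stable_from:
  assumes "2 * n \<le> L"
  shows "stable L"
proof -
  let ?c = "\<lambda>L. card (word L ` {..<2 * n})"
  have "L < ?c L \<or> (\<exists>l<L. stable l)" for L
  proof (induction L)
    case 0
    then show ?case using s_less by (auto simp: card_gt_0_iff lessThan_empty_iff)
  next
    case (Suc L)
    show ?case
    proof (cases "\<exists>l<Suc L. stable l")
      case False
      with Suc have c: "L < ?c L" "\<not> stable L" by auto
      have im: "word L ` {..<2 * n} = take L ` word (Suc L) ` {..<2 * n}"
        using take_word[where L = L and M = "Suc L"] by (force simp: image_image)
      then have "?c L \<le> ?c (Suc L)" by (simp add: card_image_le)
      moreover have "?c L \<noteq> ?c (Suc L)"
      proof
        assume "?c L = ?c (Suc L)"
        then have "inj_on (take L) (word (Suc L) ` {..<2 * n})"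
          unfolding im by (intro eq_card_imp_inj_on) auto
        moreover have "take L (word (Suc L) i) = word L i" if "i < 2 * n" for i
          using take_word[OF that] by simp
        ultimately have "stable L" unfolding stable_def inj_on_def
          by (metis imageI lessThan_iff)
        with c show False by simp
      qed
      ultimately show ?thesis using c by linarith
    qed auto
  qed
  from this[of L] obtain l where "l < L" "stable l"
    using assms card_image_le[of "{..<2 * n}" "word L"] by auto
  have "stable (l + k)" for k
    by (induction k) (use \<open>stable l\<close> stable_Suc in auto)
  from this[of "L - l"] \<open>l < L\<close> show ?thesis by simp
qed

lemma word_eq_all:
  assumes "2 * n \<le> N" "i < 2 * n" "j < 2 * n" "word N i = word N j"
  shows "word L i = word L j"
proof (cases "L \<le> N")
  case True
  then show ?thesis using assms take_word by metis
next
  case False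
  then have "N \<le> L" by simp
  then show ?thesis
  proof (induction L rule: dec_induct)
    case (step L)
    then have "stable L" using assms(1) by (intro stable_from) simp
    with step.IH assms(2,3) show ?case unfolding stable_def by blast
  qed (use assms in simp)
qed

lemma lo_le_hi: "u < n \<Longrightarrow> word L u \<le> word L (n + u)"
  using lo_le[of u "hi L u" L] hi_W[of u L] by (simp add: word_def)

lemma all_less_iff:
  assumes N: "2 * n \<le> N" and u: "u < n" and v: "v < n"
  shows "(\<forall>\<alpha>\<in>R u. \<forall>\<beta>\<in>R v. \<alpha> < \<beta>) \<longleftrightarrow> u \<noteq> v \<and> word N (n + u) \<le> word N v"
proof
  assume less: "\<forall>\<alpha>\<in>R u. \<forall>\<beta>\<in>R v. \<alpha> < \<beta>"
  have "u \<noteq> v" using less reachable[OF u] by (force simp: R_def)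
  moreover have "hi N u \<le> lo N v"
  proof -
    obtain p where p: "p < n" "dw d (hi N u) p = u" using hi_W[OF u, of N] by (auto simp: W_def)
    obtain q where q: "q < n" "dw d (lo N v) q = v" using lo_W[OF v, of N] by (auto simp: W_def)
    obtain x where "dw d x s = p" using reachable[OF p(1)] by auto
    with p strip_padding[of "hi N u @ x" u] u obtain \<alpha> k where
      \<alpha>: "\<alpha> \<in> R u" "hi N u @ x = \<alpha> @ replicate k 0" by (auto simp: dw_append)
    obtain y where "dw d y s = q" using reachable[OF q(1)] by auto
    with q strip_padding[of "lo N v @ y" v] v obtain \<beta> l where
      \<beta>: "\<beta> \<in> R v" "lo N v @ y = \<beta> @ replicate l 0" by (auto simp: dw_append)
    have len: "length (hi N u) = N" "length (lo N v) = N"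
      using length_W[OF hi_W[OF u]] length_W[OF lo_W[OF v]] by auto
    then have "N \<le> length \<alpha> + k" "N \<le> length \<beta> + l"
      using arg_cong[OF \<alpha>(2), of length] arg_cong[OF \<beta>(2), of length] by auto
    with less \<alpha>(1) \<beta>(1) have "take N (\<alpha> @ replicate k 0) \<le> take N (\<beta> @ replicate l 0)"
      by (intro take_pad_mono) (auto simp: R_def)
    then show ?thesis using len \<alpha>(2) \<beta>(2) by (metis append_eq_conv_conj)
  qed
  ultimately show "u \<noteq> v \<and> word N (n + u) \<le> word N v" using v by (simp add: word_def)
next
  assume A: "u \<noteq> v \<and> word N (n + u) \<le> word N v"
  have le: "hi L u \<le> lo L v" for L
  proof -
    have nodes: "n + u < 2 * n" "v < 2 * n" using u v by auto
    consider "L \<le> N" | "N < L" "word N (n + u) < word N v" | "word N (n + u) = word N v"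
      using A by force
    then have "word L (n + u) \<le> word L v"
    proof cases
      case 1
      then show ?thesis using A word_mono(1)[OF nodes] by auto
    next
      case 2
      then show ?thesis using word_mono(2)[OF nodes, of N L] by auto
    next
      case 3
      then show ?thesis using word_eq_all[OF N nodes] by auto
    qed
    then show ?thesis using v by (simp add: word_def)
  qed
  show "\<forall>\<alpha>\<in>R u. \<forall>\<beta>\<in>R v. \<alpha> < \<beta>"
  proof (intro ballI)
    fix \<alpha> \<beta> assume \<alpha>: "\<alpha> \<in> R u" and \<beta>: "\<beta> \<in> R v"
    define L where "L = max (length \<alpha>) (length \<beta>)"
    let ?a = "\<alpha> @ replicate (L - length \<alpha>) 0" and ?b = "\<beta> @ replicate (L - length \<beta>) 0"
    have "?a \<in> W L u" "?b \<in> W L v" using \<alpha> \<beta> by (auto intro!: pad_in_W simp: L_def)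
    then have ab: "?a \<le> ?b" using le[of L] hi_ge[OF u] lo_le[OF v] by (meson order_trans)
    have ne: "\<alpha> \<noteq> \<beta>" using \<alpha> \<beta> A by (auto simp: R_def)
    show "\<alpha> < \<beta>"
    proof (rule ccontr)
      assume "\<not> \<alpha> < \<beta>"
      with ne have "\<beta> < \<alpha>" by simp
      then have "take L ?b \<le> take L ?a" using \<alpha> by (intro take_pad_mono) (auto simp: R_def L_def)
      then have "?b \<le> ?a" by (simp add: L_def)
      with ab have "?a = ?b" by simp
      with pad_inject ne \<alpha> \<beta> show False by (auto simp: R_def)
    qed
  qed
qed

end

section \<open>From the encoded automaton to the padded automaton\<close>

lemma colex_less_iff_rev: "colex_less \<alpha> \<beta> \<longleftrightarrow> rev \<alpha> < rev \<beta>"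
proof
  show "colex_less \<alpha> \<beta> \<Longrightarrow> rev \<alpha> < rev \<beta>"
  proof (induction rule: colex_less.induct)
    case (1 \<alpha>)
    then show ?case by (cases \<alpha> rule: rev_cases) auto
  qed auto
  show "rev \<alpha> < rev \<beta> \<Longrightarrow> colex_less \<alpha> \<beta>"
  proof (induction \<alpha> arbitrary: \<beta> rule: rev_induct)
    case Nil
    then show ?case by (auto intro: colex_less.intros)
  next
    case (snoc a \<alpha>)
    then show ?case by (cases \<beta> rule: rev_cases) (auto intro: colex_less.intros)
  qed
qed

lemma map_less_map_iff:
  fixes f :: "'b::linorder \<Rightarrow> 'c::linorder"
  assumes "strict_mono_on U f" "set xs \<subseteq> U" "set ys \<subseteq> U"
  shows "map f xs < map f ys \<longleftrightarrow> xs < ys"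
  using assms(2,3)
proof (induction xs arbitrary: ys)
  case Nil
  then show ?case by (cases ys) auto
next
  case (Cons x xs)
  then show ?case
    using strict_mono_on_eqD[OF assms(1), of x "hd ys"] strict_mono_on_less[OF assms(1), of x "hd ys"]
    by (cases ys) auto
qed

lemma trans_word_snoc:
  "trans_word A u (\<alpha> @ [a]) = Some q \<longleftrightarrow> (\<exists>p. trans_word A u \<alpha> = Some p \<and> trans A p a = Some q)"
  by (induction \<alpha> arbitrary: u) (auto split: option.splits)

locale encoded_dfa =
  fixes A :: "('q, 'a::linorder) dfa" and idx code es w
  assumes wf: "wf_dfa A" and no_incoming: "init_has_no_incoming A" and reachable_all: "all_reachable A"
    and consistent: "input_consistent A" and enc: "dfa_encoding w A idx code es"
begin

definition n :: nat where "n = card (states A)"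

definition s :: nat where "s = idx (init A)"

definition lcode :: "nat \<Rightarrow> nat" where
  "lcode u = (if \<exists>p a q. (p, a, q) \<in> set es \<and> idx q = u
     then SOME c. \<exists>p a q. (p, a, q) \<in> set es \<and> idx q = u \<and> c = code a else 0)"

definition rk :: "nat \<Rightarrow> nat" where
  "rk c = 1 + card {x. x < n \<and> x \<noteq> s \<and> lcode x < c}"

definition lab :: "nat \<Rightarrow> nat" where
  "lab u = (if u = s then 0 else rk (lcode u))"

definition d :: "nat \<Rightarrow> nat \<Rightarrow> nat" where
  "d c v = (if c = 0 then if v = s then s else n
     else if \<exists>p a q. (p, a, q) \<in> set es \<and> idx p = v \<and> lab (idx q) = c
     then SOME u. \<exists>p a q. (p, a, q) \<in> set es \<and> idx p = v \<and> lab (idx q) = c \<and> u = idx q else n)"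

lemma idx_inj: "p \<in> states A \<Longrightarrow> q \<in> states A \<Longrightarrow> idx p = idx q \<longleftrightarrow> p = q"
  using enc by (auto simp: dfa_encoding_def bij_betw_def inj_on_def)

lemma idx_less: "p \<in> states A \<Longrightarrow> idx p < n"
  using enc by (auto simp: dfa_encoding_def bij_betw_def n_def)

lemma idx_surj: "u < n \<Longrightarrow> \<exists>p\<in>states A. idx p = u"
proof -
  assume "u < n"
  moreover have "idx ` states A = {..<n}" using enc by (simp add: dfa_encoding_def bij_betw_def n_def)
  ultimately show ?thesis by (metis imageE lessThan_iff)
qed

lemma edge_iff: "(p, a, q) \<in> set es \<longleftrightarrow> trans A p a = Some q"
  using enc by (auto simp: dfa_encoding_def)

lemma edgeD:
  assumes "(p, a, q) \<in> set es"
  shows "p \<in> states A" "a \<in> alphabet A" "q \<in> states A" "q \<noteq> init A" "idx q \<noteq> s" "idx p < n" "idx q < n"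
proof -
  from assms have t: "trans A p a = Some q" by (simp add: edge_iff)
  then show *: "p \<in> states A" "a \<in> alphabet A" "q \<in> states A" using wf unfolding wf_dfa_def by blast+
  show "q \<noteq> init A" using t no_incoming by (auto simp: init_has_no_incoming_def)
  then show "idx q \<noteq> s" using * wf idx_inj by (auto simp: s_def wf_dfa_def)
  show "idx p < n" "idx q < n" using * idx_less by auto
qed

lemma same_label: "(p, a, q) \<in> set es \<Longrightarrow> (p', a', q) \<in> set es \<Longrightarrow> a = a'"
  using consistent unfolding input_consistent_def edge_iff by blast

lemma lcode_edge: "(p, a, q) \<in> set es \<Longrightarrow> lcode (idx q) = code a"
proof -
  assume e: "(p, a, q) \<in> set es"
  have "c = code a" if "\<exists>p' a' q'. (p', a', q') \<in> set es \<and> idx q' = idx q \<and> c = code a'" for c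
    using that e edgeD(3) idx_inj same_label by metis
  with e show ?thesis unfolding lcode_def by (auto intro!: some_equality)
qed

lemma lcode_no_edge: "(\<And>p a q. (p, a, q) \<in> set es \<Longrightarrow> idx q \<noteq> u) \<Longrightarrow> lcode u = 0"
  unfolding lcode_def by (rule if_not_P) blast

definition used :: "'a set" where "used = {a. \<exists>p q. (p, a, q) \<in> set es}"

lemma rk_strict_mono: "strict_mono_on used (\<lambda>a. rk (code a))"
proof (rule strict_mono_onI)
  fix a b assume ab: "a \<in> used" "b \<in> used" "a < b"
  then obtain p q where e: "(p, a, q) \<in> set es" by (auto simp: used_def)
  have "code a < code b" using ab enc edgeD(2)
    by (auto simp: used_def dfa_encoding_def strict_mono_on_def)
  then have "{x. x < n \<and> x \<noteq> s \<and> lcode x < code a} \<subseteq> {x. x < n \<and> x \<noteq> s \<and> lcode x < code b}"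
    and "idx q \<in> {x. x < n \<and> x \<noteq> s \<and> lcode x < code b}"
    and "idx q \<notin> {x. x < n \<and> x \<noteq> s \<and> lcode x < code a}"
    using edgeD(5,7)[OF e] lcode_edge[OF e] by auto
  then have "{x. x < n \<and> x \<noteq> s \<and> lcode x < code a} \<subset> {x. x < n \<and> x \<noteq> s \<and> lcode x < code b}"
    by blast
  then have "card {x. x < n \<and> x \<noteq> s \<and> lcode x < code a} < card {x. x < n \<and> x \<noteq> s \<and> lcode x < code b}"
    by (intro psubset_card_mono) auto
  then show "rk (code a) < rk (code b)" by (simp add: rk_def)
qed

lemma lab_edge: "(p, a, q) \<in> set es \<Longrightarrow> lab (idx q) = rk (code a)"
  using edgeD(5) lcode_edge by (simp add: lab_def)

lemma rk_eq: "a \<in> used \<Longrightarrow> b \<in> used \<Longrightarrow> rk (code a) = rk (code b) \<longleftrightarrow> a = b"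
  using strict_mono_on_eqD[OF rk_strict_mono] by blast

lemma edge_target_unique:
  assumes "(p, a, q) \<in> set es" "(p', a', q') \<in> set es" "idx p = idx p'" "lab (idx q) = lab (idx q')"
  shows "q = q'"
proof -
  have "a = a'" using assms lab_edge rk_eq unfolding used_def by (metis (mono_tags, lifting) mem_Collect_eq)
  moreover have "p = p'" using assms edgeD(1) idx_inj by metis
  ultimately show ?thesis using assms edge_iff by auto
qed

lemma lab_pos: "(p, a, q) \<in> set es \<Longrightarrow> 0 < lab (idx q)"
  using lab_edge by (simp add: rk_def)

lemma d_edge: "(p, a, q) \<in> set es \<Longrightarrow> d (lab (idx q)) (idx p) = idx q"
proof -
  assume e: "(p, a, q) \<in> set es"
  have "u = idx q"
    if "\<exists>p' a' q'. (p', a', q') \<in> set es \<and> idx p' = idx p \<and> lab (idx q') = lab (idx q) \<and> u = idx q'" for u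
    using that e edge_target_unique by metis
  with e lab_pos[OF e] show ?thesis unfolding d_def by (auto intro!: some_equality)
qed

lemma d_no_edge:
  assumes "\<And>p a q. (p, a, q) \<in> set es \<Longrightarrow> idx p = v \<Longrightarrow> lab (idx q) \<noteq> c" "c \<noteq> 0 \<or> v \<noteq> s"
  shows "d c v = n"
  using assms unfolding d_def by (auto split: if_splits)

lemma d_cases:
  obtains "c = 0" "v = s" "d c v = s" | "d c v = n"
  | p a q where "(p, a, q) \<in> set es" "idx p = v" "lab (idx q) = c" "d c v = idx q" "c \<noteq> 0"
proof (cases "c = 0")
  case True
  then show ?thesis using that(1,2) by (cases "v = s") (simp_all add: d_def)
next
  case False
  show ?thesis
  proof (cases "\<exists>p a q. (p, a, q) \<in> set es \<and> idx p = v \<and> lab (idx q) = c")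
    case True
    then show ?thesis using that(3) d_edge False by metis
  next
    case F: False
    then show ?thesis using that(2) d_no_edge False by metis
  qed
qed

lemma s_less: "s < n"
  using wf idx_less by (auto simp: s_def wf_dfa_def)

lemma dw_of_trans_word:
  "trans_word A (init A) \<alpha> = Some q \<Longrightarrow>
     dw d (map (\<lambda>a. rk (code a)) (rev \<alpha>)) s = idx q \<and> set \<alpha> \<subseteq> used"
proof (induction \<alpha> arbitrary: q rule: rev_induct)
  case Nil
  then show ?case by (simp add: s_def)
next
  case (snoc a \<alpha>)
  then obtain p where p: "trans_word A (init A) \<alpha> = Some p" "trans A p a = Some q"
    by (auto simp: trans_word_snoc)
  then have e: "(p, a, q) \<in> set es" by (simp add: edge_iff)
  with d_edge[OF e] lab_edge[OF e] snoc.IH[OF p(1)] show ?case by (auto simp: used_def)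
qed

lemma trans_word_of_dw:
  "dw d x s = idx q \<Longrightarrow> q \<in> states A \<Longrightarrow> 0 \<notin> set x \<Longrightarrow>
     \<exists>\<alpha>. trans_word A (init A) \<alpha> = Some q \<and> \<alpha> \<in> lists (alphabet A) \<and> x = map (\<lambda>a. rk (code a)) (rev \<alpha>)"
proof (induction x arbitrary: q)
  case Nil
  then have "q = init A" using wf idx_inj by (auto simp: s_def wf_dfa_def)
  then show ?case by (intro exI[of _ "[]"]) auto
next
  case (Cons c x)
  have "d c (dw d x s) = idx q" "c \<noteq> 0" "idx q < n" using Cons.prems idx_less by auto
  then obtain p a q' where e: "(p, a, q') \<in> set es" "idx p = dw d x s" "lab (idx q') = c" "idx q = idx q'"
    by (cases rule: d_cases[of c "dw d x s"]) auto
  then have q: "q' = q" using idx_inj edgeD(3) Cons.prems(2) by metis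
  from Cons.IH[of p] e edgeD(1)[OF e(1)] Cons.prems obtain \<alpha> where
    \<alpha>: "trans_word A (init A) \<alpha> = Some p" "\<alpha> \<in> lists (alphabet A)" "x = map (\<lambda>a. rk (code a)) (rev \<alpha>)" by auto
  have "trans_word A (init A) (\<alpha> @ [a]) = Some q"
    using \<alpha>(1) e(1) q by (simp add: trans_word_snoc edge_iff)
  moreover have "c # x = map (\<lambda>a. rk (code a)) (rev (\<alpha> @ [a]))" using \<alpha>(3) lab_edge[OF e(1)] e(3) by simp
  moreover have "\<alpha> @ [a] \<in> lists (alphabet A)" using \<alpha>(2) edgeD(2)[OF e(1)] by auto
  ultimately show ?case by (intro exI[of _ "\<alpha> @ [a]"] conjI)
qed

lemma padded: "padded_dfa n s lab d"
proof
  show "s < n" by (rule s_less)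
  show "lab s = 0" by (simp add: lab_def)
  show "d c v \<le> n" for c v
    by (cases rule: d_cases[of c v]) (use s_less edgeD(7) in fastforce)+
  show "d c v = n" if "n \<le> v" for c v
    by (cases rule: d_cases[of c v]) (use s_less edgeD(6) that in fastforce)+
  show "lab (d c v) = c" if "d c v < n" for c v
    by (cases rule: d_cases[of c v]) (use that in \<open>auto simp: lab_def\<close>)
  show "d 0 v = (if v = s then s else n)" for v by (simp add: d_def)
  show "\<exists>x. 0 \<notin> set x \<and> dw d x s = u" if "u < n" for u
  proof -
    from idx_surj[OF that] obtain q where q: "q \<in> states A" "idx q = u" by auto
    with reachable_all obtain \<alpha> where "trans_word A (init A) \<alpha> = Some q"
      by (auto simp: all_reachable_def reaching_words_def)
    from dw_of_trans_word[OF this] q show ?thesis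
      by (intro exI[of _ "map (\<lambda>a. rk (code a)) (rev \<alpha>)"]) (auto simp: rk_def)
  qed
qed

sublocale padded_dfa n s lab d by (rule padded)

lemma R_idx: "q \<in> states A \<Longrightarrow> R (idx q) = (\<lambda>\<alpha>. map (\<lambda>a. rk (code a)) (rev \<alpha>)) ` reaching_words A q"
proof (intro equalityI subsetI)
  fix x assume q: "q \<in> states A"
  show "x \<in> (\<lambda>\<alpha>. map (\<lambda>a. rk (code a)) (rev \<alpha>)) ` reaching_words A q" if "x \<in> R (idx q)"
    using trans_word_of_dw[OF _ q, of x] that unfolding R_def reaching_words_def by blast
  show "x \<in> R (idx q)" if "x \<in> (\<lambda>\<alpha>. map (\<lambda>a. rk (code a)) (rev \<alpha>)) ` reaching_words A q"
    using dw_of_trans_word[of _ q] that unfolding R_def reaching_words_def by (auto simp: rk_def)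
qed

lemma state_less_iff_words:
  assumes "p \<in> states A" "q \<in> states A"
  shows "state_less A p q \<longleftrightarrow> (\<forall>\<alpha>\<in>R (idx p). \<forall>\<beta>\<in>R (idx q). \<alpha> < \<beta>)"
proof -
  have "colex_less \<alpha> \<beta> \<longleftrightarrow> map (\<lambda>a. rk (code a)) (rev \<alpha>) < map (\<lambda>a. rk (code a)) (rev \<beta>)"
    if "\<alpha> \<in> reaching_words A p" "\<beta> \<in> reaching_words A q" for \<alpha> \<beta>
    using map_less_map_iff[OF rk_strict_mono, of "rev \<alpha>" "rev \<beta>"] dw_of_trans_word[of \<alpha> p]
      dw_of_trans_word[of \<beta> q] that by (auto simp: colex_less_iff_rev reaching_words_def)
  then show ?thesis unfolding R_idx[OF assms(1)] R_idx[OF assms(2)] state_less_def by auto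
qed

lemma length_es: "length es \<le> n ^ 2"
proof -
  let ?f = "\<lambda>(p, a, q). (idx p, idx q)"
  have "inj_on ?f (set es)"
  proof (rule inj_onI)
    fix x y assume xy: "x \<in> set es" "y \<in> set es" "?f x = ?f y"
    obtain p a q p' a' q' where e: "x = (p, a, q)" "y = (p', a', q')" by (cases x, cases y)
    with xy have e': "(p, a, q) \<in> set es" "(p', a', q') \<in> set es" "idx p = idx p'" "idx q = idx q'"
      by auto
    then have "p = p'" "q = q'"
      using idx_inj edgeD(1)[OF e'(1)] edgeD(1)[OF e'(2)] edgeD(3)[OF e'(1)] edgeD(3)[OF e'(2)] by auto
    with e e' same_label[of p a q p' a'] show "x = y" by auto
  qed
  moreover have "?f ` set es \<subseteq> {..<n} \<times> {..<n}" using edgeD by auto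
  ultimately have "card (set es) \<le> card ({..<n} \<times> {..<n})" by (intro card_inj_on_le) auto
  moreover have "distinct es" using enc by (simp add: dfa_encoding_def)
  ultimately show ?thesis by (simp add: distinct_card power2_eq_square)
qed

end

section \<open>Greedy colouring of intervals\<close>

definition interval_coloring :: "nat \<Rightarrow> (nat \<Rightarrow> nat) \<Rightarrow> (nat \<Rightarrow> nat) \<Rightarrow> (nat \<Rightarrow> nat) \<Rightarrow> nat \<Rightarrow> bool" where
  "interval_coloring n lo hi out M \<longleftrightarrow>
     (\<forall>x<n. \<forall>y<n. x \<noteq> y \<longrightarrow> out x \<noteq> 0 \<longrightarrow> out x = out y \<longrightarrow> hi x \<le> lo y \<or> hi y \<le> lo x) \<and>
     (\<forall>x<n. out x \<le> M) \<and>
     (\<exists>S \<subseteq> {x. x < n \<and> out x \<noteq> 0}. card S = M \<and> (\<forall>x\<in>S. \<forall>y\<in>S. x \<noteq> y \<longrightarrow> \<not> hi x \<le> lo y))"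

text \<open>The intervals are coloured in the order of their lower, then of their upper end points. Colour
  \<open>0\<close> means uncoloured, and \<open>ends c\<close> is the upper end of the rightmost interval of colour
  \<open>Suc c\<close>. The antichain \<open>S\<close> in the definition above certifies that no fewer colours suffice.\<close>

definition greedy_state ::
  "nat \<Rightarrow> (nat \<Rightarrow> nat) \<Rightarrow> (nat \<Rightarrow> nat) \<Rightarrow> (nat \<Rightarrow> nat) \<Rightarrow> (nat \<Rightarrow> nat) \<Rightarrow> nat \<Rightarrow> nat \<Rightarrow> bool" where
  "greedy_state n lo hi out ends t M \<longleftrightarrow>
     interval_coloring n lo hi out M \<and> card {x. x < n \<and> out x \<noteq> 0} = t \<and>
     (\<forall>x<n. \<forall>y<n. out x \<noteq> 0 \<longrightarrow> out y = 0 \<longrightarrow> lo x < lo y \<or> lo x = lo y \<and> hi x \<le> hi y) \<and>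
     (\<forall>c<M. \<exists>x<n. out x = Suc c \<and> ends c = hi x \<and> (\<forall>y<n. out y = Suc c \<longrightarrow> hi y \<le> ends c)) \<and>
     (\<forall>c\<ge>M. ends c = 0)"

lemma greedy_state_0: "greedy_state n lo hi (\<lambda>_. 0) (\<lambda>_. 0) 0 0"
  by (auto simp: greedy_state_def interval_coloring_def)

lemma greedy_state_bound: "greedy_state n lo hi out ends t M \<Longrightarrow> M \<le> n"
proof -
  assume "greedy_state n lo hi out ends t M"
  then obtain S where "S \<subseteq> {x. x < n \<and> out x \<noteq> 0}" "card S = M"
    by (auto simp: greedy_state_def interval_coloring_def)
  then have "S \<subseteq> {..<n}" by auto
  from card_mono[OF _ this] \<open>card S = M\<close> show ?thesis by simp
qed

lemma greedy_state_step:
  assumes g: "greedy_state n lo hi out ends t M" and u: "u < n" "out u = 0"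
    and lohi: "\<And>x. x < n \<Longrightarrow> lo x \<le> hi x"
    and min: "\<And>y. y < n \<Longrightarrow> out y = 0 \<Longrightarrow> lo u < lo y \<or> lo u = lo y \<and> hi u \<le> hi y"
    and c: "c \<le> M" "ends c \<le> lo u" "\<And>c'. c' < c \<Longrightarrow> lo u < ends c'"
  shows "\<exists>M'. greedy_state n lo hi (out(u := Suc c)) (ends(c := hi u)) (Suc t) M'"
proof -
  note g' = g[unfolded greedy_state_def interval_coloring_def]
  from g' obtain S where S: "S \<subseteq> {x. x < n \<and> out x \<noteq> 0}" "card S = M"
      "\<forall>x\<in>S. \<forall>y\<in>S. x \<noteq> y \<longrightarrow> \<not> hi x \<le> lo y"
    by (elim conjE exE)
  from g' have chain: "\<And>x y. x < n \<Longrightarrow> y < n \<Longrightarrow> x \<noteq> y \<Longrightarrow> out x \<noteq> 0 \<Longrightarrow> out x = out y \<Longrightarrow> hi x \<le> lo y \<or> hi y \<le> lo x"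
    and outM: "\<And>x. x < n \<Longrightarrow> out x \<le> M"
    and cardt: "card {x. x < n \<and> out x \<noteq> 0} = t"
    and order: "\<And>x y. x < n \<Longrightarrow> y < n \<Longrightarrow> out x \<noteq> 0 \<Longrightarrow> out y = 0 \<Longrightarrow> lo x < lo y \<or> lo x = lo y \<and> hi x \<le> hi y"
    and lasts: "\<And>c. c < M \<Longrightarrow> \<exists>x<n. out x = Suc c \<and> ends c = hi x \<and> (\<forall>y<n. out y = Suc c \<longrightarrow> hi y \<le> ends c)"
    and last0: "\<And>c. c \<ge> M \<Longrightarrow> ends c = 0"
    by (elim conjE; simp)+
  let ?out = "out(u := Suc c)" and ?ends = "ends(c := hi u)"
  have below: "hi y \<le> lo u" if "y < n" "out y = Suc c" for y
    using lasts[of c] outM[OF that(1)] that c(2) by fastforce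
  have chain': "hi x \<le> lo y \<or> hi y \<le> lo x"
    if "x < n" "y < n" "x \<noteq> y" "?out x \<noteq> 0" "?out x = ?out y" for x y
    using that chain[of x y] below by (auto split: if_splits)
  have "{x. x < n \<and> ?out x \<noteq> 0} = insert u {x. x < n \<and> out x \<noteq> 0}" using u by auto
  then have cardt': "card {x. x < n \<and> ?out x \<noteq> 0} = Suc t" using cardt u by simp
  have order': "lo x < lo y \<or> lo x = lo y \<and> hi x \<le> hi y"
    if "x < n" "y < n" "?out x \<noteq> 0" "?out y = 0" for x y
    using that order[of x y] min by (auto split: if_splits)
  have last_c: "\<exists>x<n. ?out x = Suc c \<and> ?ends c = hi x \<and> (\<forall>y<n. ?out y = Suc c \<longrightarrow> hi y \<le> ?ends c)"
    using u below lohi[OF u(1)] by (intro exI[of _ u]) force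
  have last_other: "\<exists>x<n. ?out x = Suc c' \<and> ?ends c' = hi x \<and> (\<forall>y<n. ?out y = Suc c' \<longrightarrow> hi y \<le> ?ends c')"
    if "c' < M" "c' \<noteq> c" for c'
  proof -
    from lasts[OF that(1)] obtain x where
      x: "x < n" "out x = Suc c'" "ends c' = hi x" "\<forall>y<n. out y = Suc c' \<longrightarrow> hi y \<le> ends c'" by blast
    then have "x \<noteq> u" using u by auto
    with x that(2) show ?thesis by (intro exI[of _ x]) auto
  qed
  show ?thesis
  proof (cases "c < M")
    case True
    have "S \<subseteq> {x. x < n \<and> ?out x \<noteq> 0}" using S(1) by auto
    then have "interval_coloring n lo hi ?out M"
      unfolding interval_coloring_def using S chain' outM True by (auto simp del: fun_upd_apply) (auto simp: Suc_le_eq)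
    moreover have "\<exists>x<n. ?out x = Suc c' \<and> ?ends c' = hi x \<and> (\<forall>y<n. ?out y = Suc c' \<longrightarrow> hi y \<le> ?ends c')"
      if "c' < M" for c'
      using last_c last_other[OF that] by (cases "c' = c") blast+
    ultimately have "greedy_state n lo hi ?out ?ends (Suc t) M"
      unfolding greedy_state_def using cardt' order' last0 True by (auto simp del: fun_upd_apply) auto
    then show ?thesis by blast
  next
    case False
    then have cM: "c = M" using c by simp
    from lasts obtain f where f: "\<And>c. c < M \<Longrightarrow> f c < n \<and> out (f c) = Suc c \<and> ends c = hi (f c)" by metis
    have inj: "inj_on f {..<M}" by (rule inj_onI) (metis f lessThan_iff nat.inject)
    let ?S = "insert u (f ` {..<M})"
    have "u \<notin> f ` {..<M}" using f u by force
    then have "card ?S = Suc M" using inj by (simp add: card_image)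
    moreover have "?S \<subseteq> {x. x < n \<and> ?out x \<noteq> 0}" using f u by auto
    moreover have "\<not> hi x \<le> lo y" if "x \<in> ?S" "y \<in> ?S" "x \<noteq> y" for x y
    proof -
      have hi: "lo u < hi (f k)" if "k < M" for k using f[OF that] c(3)[of k] cM that by auto
      have ord: "lo (f k) < lo u \<or> lo (f k) = lo u \<and> hi (f k) \<le> hi u" if "k < M" for k
        using order[of "f k" u] f[OF that] u by auto
      from that consider k where "x = f k" "k < M" "lo y \<le> lo u" | k where "x = u" "y = f k" "k < M"
        using ord by fastforce
      then show ?thesis
      proof cases
        case 1
        then show ?thesis using hi[of k] by simp
      next
        case 2
        then show ?thesis using hi[of k] ord[of k] lohi[OF u(1)] by auto
      qed
    qed
    ultimately have "\<exists>S\<subseteq>{x. x < n \<and> ?out x \<noteq> 0}. card S = Suc M \<and>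
        (\<forall>x\<in>S. \<forall>y\<in>S. x \<noteq> y \<longrightarrow> \<not> hi x \<le> lo y)"
      by (intro exI[of _ ?S]) blast
    moreover have "?out x \<le> Suc M" if "x < n" for x using outM[OF that] cM by simp
    ultimately have "interval_coloring n lo hi ?out (Suc M)"
      unfolding interval_coloring_def using chain' by blast
    moreover have "\<exists>x<n. ?out x = Suc c' \<and> ?ends c' = hi x \<and> (\<forall>y<n. ?out y = Suc c' \<longrightarrow> hi y \<le> ?ends c')"
      if "c' < Suc M" for c'
      using last_c last_other[of c'] that cM by (cases "c' = c") (blast, simp)
    ultimately have "greedy_state n lo hi ?out ?ends (Suc t) (Suc M)"
      unfolding greedy_state_def using cardt' order' last0 cM by (auto simp del: fun_upd_apply) auto
    then show ?thesis by blast
  qed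
qed

section \<open>Correctness and running time\<close>

lemma card_less_iff:
  fixes f :: "nat \<Rightarrow> 'b::linorder"
  assumes "i < N" "j < N"
  shows "card {y. y < N \<and> f y < f i} < card {y. y < N \<and> f y < f j} \<longleftrightarrow> f i < f j"
proof -
  have *: "card {y. y < N \<and> f y < f a} < card {y. y < N \<and> f y < f b}" if "f a < f b" "a < N" for a b
  proof (rule psubset_card_mono)
    show "{y. y < N \<and> f y < f a} \<subset> {y. y < N \<and> f y < f b}"
      using that by (intro psubsetI) (auto dest: less_trans)
  qed simp
  show ?thesis
    using *[of i j] *[of j i] assms by (cases "f i" "f j" rule: linorder_cases) auto
qed

locale sized_dfa = encoded_dfa +
  assumes word_size: "(card (states A) + 2) ^ 4 \<le> 2 ^ w"
begin

text \<open>Named constants, lest simplification distributes products over \<open>n + 1\<close> in addresses and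
  keys.\<close>

definition st :: nat where "st = n + 1"

definition rb :: nat where "rb = 2 * n + 1"

lemma n_pos: "0 < n" using s_less by simp

lemma rb_sq_less: "rb * rb < 2 ^ w"
proof -
  have "rb * rb < (2 * (n + 2)) * (2 * (n + 2))" unfolding rb_def by (intro mult_strict_mono) auto
  also have "\<dots> = 4 * (n + 2) ^ 2" by (simp add: power2_eq_square)
  also have "\<dots> \<le> (n + 2) ^ 2 * (n + 2) ^ 2" by (intro mult_right_mono) (auto simp: power2_eq_square)
  also have "\<dots> = (n + 2) ^ 4" by (simp flip: power_add)
  also have "\<dots> \<le> 2 ^ w" using word_size by (simp add: n_def)
  finally show ?thesis .
qed

lemma lin_less: "x \<le> 4 * n + 4 \<Longrightarrow> x < 2 ^ w"
proof -
  assume "x \<le> 4 * n + 4"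
  also have "4 * n + 4 \<le> rb * rb"
    using n_pos unfolding rb_def by (cases n) (auto simp: algebra_simps)
  finally show ?thesis using rb_sq_less by simp
qed

lemma w_pos [simp]: "0 < w"
  using lin_less[of 1] by (cases w) auto

lemma less_rb: "r \<le> 2 * n \<Longrightarrow> r < rb"
  by (simp add: rb_def)

lemma key_less: "r \<le> 2 * n \<Longrightarrow> r' \<le> 2 * n \<Longrightarrow> r * rb + r' < rb * rb"
proof -
  assume "r \<le> 2 * n" "r' \<le> 2 * n"
  then have "r' < rb" "(r + 1) * rb \<le> rb * rb" by (simp add: rb_def, intro mult_right_mono) (auto simp: rb_def)
  then show ?thesis by simp
qed

lemma key_less_word: "r \<le> 2 * n \<Longrightarrow> r' \<le> 2 * n \<Longrightarrow> r * rb + r' < 2 ^ w"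
  using key_less rb_sq_less by (meson less_trans)

lemma key_mono:
  assumes "b \<le> 2 * n" "b' \<le> 2 * n"
  shows "a * rb + b < a' * rb + b' \<longleftrightarrow> a < a' \<or> a = a' \<and> b < b'"
proof -
  have *: "x * rb + y < x' * rb + y'" if "x < x'" "y \<le> 2 * n" for x x' y y' :: nat
  proof -
    have "x * rb + y < (x + 1) * rb" using less_rb[OF that(2)] by simp
    also have "\<dots> \<le> x' * rb" using that by (intro mult_right_mono) auto
    finally show ?thesis by simp
  qed
  show ?thesis using *[of a a' b b'] *[of a' a b' b] assms by (cases a a' rule: linorder_cases) auto
qed

lemma less_st: "r \<le> n \<Longrightarrow> r < st"
  by (simp add: st_def)

lemma addr_bound: "i < k \<Longrightarrow> v \<le> n \<Longrightarrow> i * st + v < k * st"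
proof -
  assume "i < k" "v \<le> n"
  then have "v < st" "(i + 1) * st \<le> k * st" by (simp add: st_def, intro mult_right_mono) auto
  then show ?thesis by simp
qed

lemma table_less: "k \<le> 2 * n + 1 \<Longrightarrow> k * st < 2 ^ w"
proof -
  assume "k \<le> 2 * n + 1"
  then have "k * st \<le> rb * rb" by (intro mult_mono) (auto simp: st_def rb_def)
  then show ?thesis using rb_sq_less by simp
qed

lemma addr_less: "i \<le> 2 * n \<Longrightarrow> v \<le> n \<Longrightarrow> i * st + v < 2 ^ w"
  using addr_bound[of i "i + 1" v] table_less[of "i + 1"] by simp

lemma addr_div_mod: "v \<le> n \<Longrightarrow> (i * st + v) div st = i" "v \<le> n \<Longrightarrow> (i * st + v) mod st = v"
  using div_mult_self3[of st i v] mod_mult_self3[of i st v] by (simp_all add: st_def)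

lemma addr_split: "j < k * st \<Longrightarrow> j div st < k" "j mod st \<le> n"
proof -
  show "j < k * st \<Longrightarrow> j div st < k" by (simp add: less_mult_imp_div_less)
  have "j mod st < st" by (simp add: st_def)
  then show "j mod st \<le> n" by (simp add: st_def)
qed

definition set_up :: "store \<Rightarrow> bool" where
  "set_up \<tau> \<longleftrightarrow> reg \<tau> 0 = n \<and> reg \<tau> 1 = length es \<and> reg \<tau> 2 = s \<and> reg \<tau> 8 = 2 * n \<and>
     reg \<tau> 9 = st \<and> reg \<tau> 11 = rb"

lemma set_up_agree:
  "set_up \<sigma> \<Longrightarrow> agree_off X Y \<sigma> \<tau> \<Longrightarrow> {0, 1, 2, 8, 9, 11} \<inter> X = {} \<Longrightarrow> set_up \<tau>"
  unfolding set_up_def agree_off_def by auto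

definition edges_stored :: "store \<Rightarrow> bool" where
  "edges_stored \<tau> \<longleftrightarrow> (\<forall>i<length es. cell \<tau> 0 i = idx (fst (es ! i)) \<and>
     cell \<tau> 1 i = code (fst (snd (es ! i))) \<and> cell \<tau> 2 i = idx (snd (snd (es ! i))))"

lemma edges_stored_agree:
  "edges_stored \<sigma> \<Longrightarrow> agree_off X Y \<sigma> \<tau> \<Longrightarrow> {0, 1, 2} \<inter> Y = {} \<Longrightarrow> edges_stored \<tau>"
  unfolding edges_stored_def agree_off_def by auto

lemma runs_prepare:
  "runs w prepare (input_store A idx code es) 12
    (\<lambda>\<tau>. set_up \<tau> \<and> edges_stored \<tau> \<and> (\<forall>r\<ge>4. cell \<tau> r = (\<lambda>_. 0)))"
proof -
  have "2 * n < 2 ^ w" "Suc n < 2 ^ w" "Suc (2 * n) < 2 ^ w" using lin_less by auto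
  then show ?thesis
    unfolding prepare_def
    by (intro runs_Seq[where BP = 4 and BR = 8 and Q' = "\<lambda>\<tau>. \<tau> = (input_store A idx code es)
          \<lparr>reg := (reg (input_store A idx code es))(8 := 2 * n)\<rparr>"]
        runs_Seq[where BP = 4 and BR = 4 and Q' = "\<lambda>\<tau>. \<tau> = (input_store A idx code es)
          \<lparr>reg := (reg (input_store A idx code es))(8 := 2 * n, 9 := st)\<rparr>"] runs_SetReg)
      (auto simp: input_store_def set_up_def edges_stored_def st_def rb_def n_def[symmetric] s_def)
qed

lemma edge_nth: "k < length es \<Longrightarrow> (fst (es ! k), fst (snd (es ! k)), snd (snd (es ! k))) \<in> set es"
  by simp

lemma length_es_less: "length es < 2 ^ w"
proof -
  have "n ^ 2 \<le> rb * rb" unfolding rb_def power2_eq_square by (intro mult_mono) auto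
  with length_es rb_sq_less show ?thesis by linarith
qed

lemma runs_load_labels:
  assumes "set_up \<sigma>" "edges_stored \<sigma>" "cell \<sigma> 5 = (\<lambda>_. 0)"
  shows "runs w load_labels \<sigma> (for_cost (length es) 1 5) (\<lambda>\<tau>. cell \<tau> 5 = lcode)"
  unfolding load_labels_def
proof (rule runs_For[where N = "length es" and B = 5 and I = "\<lambda>i \<tau>. \<forall>u. cell \<tau> 5 u =
    (if \<exists>k<i. idx (snd (snd (es ! k))) = u then lcode u else 0)"], goal_cases)
  case (5 i \<tau>)
  then have st: "edges_stored \<tau>" using assms edges_stored_agree[OF assms(2)] by auto
  have "lcode (idx (snd (snd (es ! i)))) = code (fst (snd (es ! i)))"
    using lcode_edge[OF edge_nth[OF 5(1)]] .
  with 5 st show ?case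
    by (intro runs_SetCell) (auto simp: edges_stored_def less_Suc_eq)
next
  case (6 \<tau>)
  have "lcode u = 0" if "\<nexists>k. k < length es \<and> idx (snd (snd (es ! k))) = u" for u
    using that by (intro lcode_no_edge) (metis in_set_conv_nth snd_conv)
  with 6 show ?case by (intro ext) metis
qed (use assms length_es_less in \<open>auto simp: set_up_def agree_off_def\<close>)

lemma runs_rank_labels:
  assumes "set_up \<sigma>" "cell \<sigma> 5 = lcode"
  shows "runs w rank_labels \<sigma> (for_cost n 1 (for_cost n 1 16 + 5) + 3)
    (\<lambda>\<tau>. \<forall>u<n. cell \<tau> 14 u = lab u)"
  unfolding rank_labels_def
proof (rule runs_Seq[where BP = "for_cost n 1 (for_cost n 1 16 + 5)" and BR = 3 and
    Q' = "\<lambda>\<tau>. \<forall>u<n. cell \<tau> 14 u = rk (lcode u)"], goal_cases)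
  case 1
  show ?case
    by (rule runs_Rank[where N = n and p = "\<lambda>x y. y \<noteq> s \<and> lcode y < lcode x"])
      (use assms lin_less in \<open>auto simp: set_up_def agree_off_def rk_def intro!: for_cost_mono\<close>)
next
  case (2 \<tau>)
  then have "reg \<tau> 2 = s" using assms by (auto simp: set_up_def agree_off_def)
  with 2 show ?case by (intro runs_SetCell) (auto simp: lab_def)
qed simp

lemma lab_le: "u < n \<Longrightarrow> lab u \<le> n"
proof -
  assume "u < n"
  have "card {x. x < n \<and> x \<noteq> s \<and> lcode x < lcode u} \<le> card ({..<n} - {s})"
    by (intro card_mono) auto
  also have "\<dots> = n - 1" using s_less by simp
  finally show ?thesis using n_pos by (auto simp: lab_def rk_def)
qed

definition ranked :: "nat \<Rightarrow> store \<Rightarrow> bool" where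
  "ranked L \<tau> \<longleftrightarrow> (\<forall>i<2*n. cell \<tau> 6 i \<le> 2 * n) \<and>
     (\<forall>i<2*n. \<forall>j<2*n. cell \<tau> 6 i < cell \<tau> 6 j \<longleftrightarrow> word L i < word L j)"

lemma word_1: "i < 2 * n \<Longrightarrow> word 1 i = [lab (i mod n)]"
proof -
  assume i: "i < 2 * n"
  from word_in_W[OF this, of 1] obtain c v where "word 1 i = [c]" "d c v = i mod n"
    by (auto simp: W_def length_Suc_conv)
  then show ?thesis using d_lab[of c v] n_pos by auto
qed

lemma runs_load_ranks:
  assumes "set_up \<sigma>" "\<forall>u<n. cell \<sigma> 14 u = lab u"
  shows "runs w load_ranks \<sigma> (for_cost (2 * n) 1 6)
    (\<lambda>\<tau>. ranked 1 \<tau> \<and> (\<forall>i<2*n. cell \<tau> 6 i = lab (i mod n)))"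
  unfolding load_ranks_def
proof (rule runs_map_loop[where N = "2 * n" and g = "\<lambda>i. lab (i mod n)"], goal_cases)
  case (3 i \<tau>)
  then show ?case using assms n_pos by (auto simp: set_up_def agree_off_def)
next
  case (4 \<tau>)
  have "lab (i mod n) \<le> 2 * n" for i using lab_le[of "i mod n"] n_pos by simp
  with 4 show ?case by (auto simp: ranked_def word_1[unfolded One_nat_def])
qed (use assms lin_less in \<open>auto simp: set_up_def agree_off_def intro!: for_cost_mono\<close>)

lemma addr_inject: "v \<le> n \<Longrightarrow> v' \<le> n \<Longrightarrow> i * st + v = i' * st + v' \<longleftrightarrow> i = i' \<and> v = v'"
  using addr_div_mod by metis

lemma runs_load_letters:
  assumes su: "set_up \<sigma>" and es: "edges_stored \<sigma>" and lb: "\<forall>u<n. cell \<sigma> 14 u = lab u"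
  shows "runs w load_letters \<sigma> (for_cost (st * st) 3 3 + for_cost (length es) 1 13 + 3)
    (\<lambda>\<tau>. \<forall>c\<le>n. \<forall>v\<le>n. cell \<tau> 13 (c * st + v) = d c v)"
  unfolding load_letters_def
proof (rule runs_Seq[where BP = "for_cost (st * st) 3 3" and BR = "for_cost (length es) 1 13 + 3" and
    Q' = "\<lambda>\<tau>. \<forall>j<st*st. cell \<tau> 13 j = n"], goal_cases)
  case 1
  have sq: "st * st < 2 ^ w" using table_less[of st] by (simp add: st_def)
  show ?case
    by (rule runs_map_loop[where N = "st * st" and g = "\<lambda>_. n"])
      (use su sq in \<open>auto simp: set_up_def agree_off_def intro!: for_cost_mono\<close>)
next
  case (2 \<tau>)
  let ?hit = "\<lambda>c v k. idx (fst (es ! k)) = v \<and> lab (idx (snd (snd (es ! k)))) = c"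
  have su': "set_up \<tau>" using set_up_agree[OF su 2(2)] by simp
  have es': "edges_stored \<tau>" using edges_stored_agree[OF es 2(2)] by simp
  have lb': "\<forall>u<n. cell \<tau> 14 u = lab u" using lb 2(2) by (auto simp: agree_off_def)
  show ?case
  proof (rule runs_Seq[where BP = "for_cost (length es) 1 13" and BR = 3 and
      Q' = "\<lambda>\<tau>. \<forall>c\<le>n. \<forall>v\<le>n. cell \<tau> 13 (c * st + v) = (if \<exists>k<length es. ?hit c v k then d c v else n)"],
      goal_cases)
    case 1
    show ?case
    proof (rule runs_For[where N = "length es" and B = 13 and
        I = "\<lambda>i \<tau>. \<forall>c\<le>n. \<forall>v\<le>n. cell \<tau> 13 (c * st + v) = (if \<exists>k<i. ?hit c v k then d c v else n)"],
        goal_cases)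
      case 4
      show ?case using 2(1) addr_bound[of _ st] less_st by simp
    next
      case (5 i \<rho>)
      have es2: "edges_stored \<rho>" using edges_stored_agree[OF es' 5(4)] by simp
      have su2: "set_up \<rho>" using set_up_agree[OF su' 5(4)] by simp
      have lb2: "\<forall>u<n. cell \<rho> 14 u = lab u" using lb' 5(4) by (auto simp: agree_off_def)
      note e = edge_nth[OF 5(1)]
      define p q c where "p = idx (fst (es ! i))" and "q = idx (snd (snd (es ! i)))" and "c = lab q"
      have pq: "p < n" "q < n" "d c p = q" "c \<le> n"
        using edgeD[OF e] d_edge[OF e] lab_le by (auto simp: p_def q_def c_def)
      have av: "aval w \<rho> (Add (Mul (Cell 14 (Cell 2 (Reg 3))) (Reg 9)) (Cell 0 (Reg 3))) = c * st + p"
        "aval w \<rho> (Cell 2 (Reg 3)) = q"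
        using 5(1,3) es2 su2 lb2 pq addr_less[of c p] addr_less[of c 0]
        by (auto simp: edges_stored_def set_up_def p_def q_def c_def)
      show ?case
      proof (rule runs_SetCell, simp, unfold av, intro allI impI, goal_cases)
        case (1 c' v')
        have hit: "?hit c' v' i \<longleftrightarrow> c' = c \<and> v' = p" by (auto simp: p_def q_def c_def)
        show ?case
        proof (cases "c' = c \<and> v' = p")
          case True
          then show ?thesis using hit pq(3) by auto
        next
          case False
          then have "c' * st + v' \<noteq> c * st + p" using addr_inject[of v' p c' c] 1 pq by auto
          then show ?thesis using False hit 5(2) 1 by (simp add: less_Suc_eq) blast
        qed
      qed
    qed (use su' length_es_less in \<open>auto simp: set_up_def agree_off_def\<close>)
  next
    case (2 \<rho>)
    have sr: "reg \<rho> 2 = s" using set_up_agree[OF su' 2(2)] by (simp add: set_up_def)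
    have val: "(if c = 0 \<and> v = s then s else if \<exists>k<length es. ?hit c v k then d c v else n) = d c v" for c v
    proof (cases "c = 0 \<and> v = s")
      case True
      then show ?thesis by (simp add: d_def)
    next
      case False
      have "d c v = n" if "\<nexists>k. k < length es \<and> ?hit c v k"
      proof (rule d_no_edge)
        fix p a q assume "(p, a, q) \<in> set es" "idx p = v"
        moreover from this obtain k where "k < length es" "es ! k = (p, a, q)" by (metis in_set_conv_nth)
        ultimately show "lab (idx q) \<noteq> c" using that by (metis fst_conv snd_conv)
      qed (use False in simp)
      then show ?thesis using False by auto
    qed
    have "(if c * st + v = s then s else cell \<rho> 13 (c * st + v)) = d c v" if "c \<le> n" "v \<le> n" for c v
    proof -
      have "c * st + v = s \<longleftrightarrow> c = 0 \<and> v = s" using addr_inject[of v s c 0] s_less that by simp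
      then show ?thesis using val[of c v] 2(1)[rule_format, OF that] by presburger
    qed
    then show ?case using sr by (intro runs_SetCell) simp_all
  qed simp
qed simp

definition tabled :: "nat \<Rightarrow> store \<Rightarrow> bool" where
  "tabled L \<tau> \<longleftrightarrow> (\<forall>i<2*n. \<forall>v\<le>n. cell \<tau> 7 (i * st + v) = dw d (word L i) v)"

lemma runs_load_table:
  assumes su: "set_up \<sigma>" and r: "\<forall>i<2*n. cell \<sigma> 6 i = lab (i mod n)"
    and l: "\<forall>c\<le>n. \<forall>v\<le>n. cell \<sigma> 13 (c * st + v) = d c v"
  shows "runs w load_table \<sigma> (for_cost (2 * n * st) 3 13) (tabled 1)"
  unfolding load_table_def
proof (rule runs_map_loop[where N = "2 * n * st" and g = "\<lambda>j. d (lab (j div st mod n)) (j mod st)"], goal_cases)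
  case (3 j \<tau>)
  have "lab (j div st mod n) \<le> n" using lab_le n_pos by simp
  then show ?case using 3 su r l addr_split(1)[of j "2 * n"] addr_split(2)[of j] addr_less[of "lab (j div st mod n)" "j mod st"]
      addr_less[of "lab (j div st mod n)" 0]
    by (simp add: set_up_def agree_offD[OF 3(2)])
next
  case (4 \<tau>)
  then show ?case
    using addr_bound[of _ "2 * n"] addr_div_mod by (simp add: tabled_def word_1[unfolded One_nat_def])
qed (use su table_less[of "2 * n"] in \<open>auto simp: set_up_def agree_off_def intro!: for_cost_mono\<close>)

lemma sub_mod: "b \<le> a \<Longrightarrow> a < 2 ^ w \<Longrightarrow> (a + 2 ^ w - b) mod 2 ^ w = a - b" for a b :: nat
proof -
  assume "b \<le> a" "a < 2 ^ w"
  then have "a + 2 ^ w - b = (a - b) + 2 ^ w" "a - b < 2 ^ w" by auto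
  then show ?thesis by (metis mod_add_self2 mod_less)
qed

definition chosen :: "nat \<Rightarrow> store \<Rightarrow> nat \<Rightarrow> bool" where
  "chosen L \<tau> i \<longleftrightarrow> (\<exists>v. optimal L L i v \<and> cell \<tau> 10 i = i - i mod n + v)"

lemma candidate_value:
  assumes "set_up \<tau>" "tabled L \<tau>" "reg \<tau> 3 = i" "reg \<tau> 4 = v" "i < 2 * n" "v < n"
  shows "bval w \<tau> candidate \<longleftrightarrow> dw d (word L i) v = i mod n"
  using assms addr_less[of i v] addr_less[of i 0] by (simp add: candidate_def set_up_def tabled_def)

lemma runs_optimal:
  assumes su: "set_up \<sigma>" and rk: "ranked L \<sigma>" and tb: "tabled L \<sigma>"
    and i: "i < 2 * n" "reg \<sigma> 3 = i" and top: "reg \<sigma> 5 = rb"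
  shows "runs w (If (Less (Reg 3) (Reg 0)) (Argmin 5 6 4 (Reg 0) candidate (Cell 6 (Reg 4)))
       (Argmin 5 6 4 (Reg 0) candidate (Sub (Reg 8) (Cell 6 (Add (Reg 0) (Reg 4))))))
     \<sigma> (for_cost n 1 29 + 4) (\<lambda>\<tau>. optimal L L i (reg \<tau> 6))"
proof -
  have env: "set_up \<tau>" "tabled L \<tau>" "reg \<tau> 3 = i" "cell \<tau> 6 = cell \<sigma> 6"
    if "agree_off {4, 5, 6} {} \<sigma> \<tau>" for \<tau>
    using that su tb i by (auto simp: agree_off_def set_up_def tabled_def)
  have cand: "bval w \<tau> candidate \<longleftrightarrow> dw d (word L i) v = i mod n"
    if "agree_off {4, 5, 6} {} \<sigma> \<tau>" "v < n" "reg \<tau> 4 = v" for \<tau> v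
    using candidate_value[OF env(1-3)[OF that(1)] that(3) i(1) that(2)] .
  have r: "cell \<sigma> 6 x \<le> 2 * n" if "x < 2 * n" for x using rk that by (simp add: ranked_def)
  have rle: "word L x \<le> word L y \<longleftrightarrow> cell \<sigma> 6 x \<le> cell \<sigma> 6 y" if "x < 2 * n" "y < 2 * n" for x y
    using rk that unfolding ranked_def by (meson not_le)
  have N: "n < 2 ^ w" "2 * n < 2 ^ w" using lin_less by auto
  show ?thesis
  proof (rule runs_If[where B' = "for_cost n 1 29"], goal_cases)
    case 1
    then have "i < n" using su i by (simp add: set_up_def)
    then have Q: "optimal L L i v" if "v < n" "dw d (word L i) v = i mod n"
      "\<And>v'. v' < n \<Longrightarrow> dw d (word L i) v' = i mod n \<Longrightarrow> cell \<sigma> 6 v \<le> cell \<sigma> 6 v'" for v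
      using that by (auto simp: optimal_def rle)
    show ?case
      by (rule runs_Argmin[where N = n and p = "\<lambda>v. dw d (word L i) v = i mod n" and g = "cell \<sigma> 6"])
        (use su N cand env r optimal_candidate[OF i(1)] top Q less_rb in
          \<open>auto simp: set_up_def candidate_def intro!: for_cost_mono simp del: bval.simps\<close>)
  next
    case 2
    then have "\<not> i < n" using su i by (simp add: set_up_def)
    have Q: "optimal L L i v" if v: "v < n" "dw d (word L i) v = i mod n"
      and min: "\<And>v'. v' < n \<Longrightarrow> dw d (word L i) v' = i mod n \<Longrightarrow>
        2 * n - cell \<sigma> 6 (n + v) \<le> 2 * n - cell \<sigma> 6 (n + v')" for v
    proof -
      have "cell \<sigma> 6 (n + v') \<le> cell \<sigma> 6 (n + v)" if "v' < n" "dw d (word L i) v' = i mod n" for v'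
        using r[of "n + v"] r[of "n + v'"] v that min[OF that] by linarith
      then show ?thesis using \<open>\<not> i < n\<close> v by (auto simp: optimal_def rle)
    qed
    have f: "aval w \<tau> (Sub (Reg 8) (Cell 6 (Add (Reg 0) (Reg 4)))) = 2 * n - cell \<sigma> 6 (n + v)"
      if "v < n" "agree_off {4, 5, 6} {} \<sigma> \<tau>" "reg \<tau> 4 = v" for v \<tau>
      using env[OF that(2)] that r[of "n + v"] sub_mod[of "cell \<sigma> 6 (n + v)" "2 * n"] N
        lin_less[of "n + v"] by (simp add: set_up_def)
    show ?case
      by (rule runs_Argmin[where N = n and p = "\<lambda>v. dw d (word L i) v = i mod n" and
            g = "\<lambda>v. 2 * n - cell \<sigma> 6 (n + v)"])
        (use su N cand env f optimal_candidate[OF i(1)] top Q less_rb in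
          \<open>auto simp: set_up_def candidate_def intro!: for_cost_mono simp del: bval.simps aval.simps(3-)\<close>)
  qed simp
qed

lemma runs_select_nodes:
  assumes su: "set_up \<sigma>" and rk: "ranked L \<sigma>" and tb: "tabled L \<sigma>"
  shows "runs w select_nodes \<sigma> (for_cost (2 * n) 1 (for_cost n 1 29 + 15)) (\<lambda>\<tau>. \<forall>i<2*n. chosen L \<tau> i)"
  unfolding select_nodes_def
proof (rule runs_For[where N = "2 * n" and B = "for_cost n 1 29 + 15" and
    I = "\<lambda>i \<tau>. \<forall>j<i. chosen L \<tau> j"], goal_cases)
  case (5 i \<tau>)
  have off: "agree_off {3, 4, 5, 6} {10} \<sigma> \<tau>" using 5(4) by (auto simp: agree_off_def)
  show ?case
  proof (rule runs_Seq[where BP = 2 and BR = "for_cost n 1 29 + 13" and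
      Q' = "\<lambda>\<rho>. reg \<rho> 5 = rb"], goal_cases)
    case 1
    show ?case using su off by (intro runs_SetReg) (auto simp: set_up_def agree_off_def)
  next
    case (2 \<rho>)
    have off2: "agree_off {3, 4, 5, 6} {10} \<sigma> \<rho>" using off 2(2) by (auto simp: agree_off_def)
    have 3: "reg \<rho> 3 = i" using 2(2) 5(3) by (auto simp: agree_off_def)
    have env: "set_up \<rho>" "ranked L \<rho>" "tabled L \<rho>"
      using set_up_agree[OF su off2] rk tb off2 by (auto simp: agree_off_def ranked_def tabled_def)
    show ?case
    proof (rule runs_Seq[where BR = 9, OF runs_optimal[OF env 5(1) 3 2(1)]], goal_cases)
      case (1 \<rho>')
      then have "reg \<rho>' 0 = n" "reg \<rho>' 3 = i" "cell \<rho>' = cell \<tau>"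
        using env(1) 2(2) 3 by (auto simp: agree_off_def set_up_def)
      moreover have v: "reg \<rho>' 6 < n" using 1(1) by (simp add: optimal_def)
      moreover have "i - i mod n < 2 ^ w" "i < 2 ^ w" "i - i mod n + reg \<rho>' 6 < 2 ^ w"
        using lin_less node_less[OF 5(1) v] 5(1) by auto
      ultimately show ?case using 1(1) 5(2) sub_mod[of "i mod n" i]
        by (intro runs_SetCell) (auto simp: chosen_def less_Suc_eq)
    qed simp
  qed simp
qed (use su lin_less in \<open>auto simp: set_up_def agree_off_def intro!: for_cost_mono\<close>)

lemma chosen_less: "chosen L \<tau> i \<Longrightarrow> i < 2 * n \<Longrightarrow> cell \<tau> 10 i < 2 * n"
  using node_less by (auto simp: chosen_def optimal_def)

lemma chosen_word: "chosen L \<tau> i \<Longrightarrow> i < 2 * n \<Longrightarrow> word (L + L) i = word L i @ word L (cell \<tau> 10 i)"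
  using word_append by (auto simp: chosen_def)

lemma runs_compose:
  assumes su: "set_up \<sigma>" and tb: "tabled L \<sigma>" and ch: "\<forall>i<2*n. chosen L \<sigma> i"
  shows "runs w compose \<sigma> (for_cost (2 * n * st) 3 20 + for_cost (2 * n * st) 3 4) (tabled (L + L))"
  unfolding compose_def
proof (rule runs_Seq[where BP = "for_cost (2 * n * st) 3 20" and BR = "for_cost (2 * n * st) 3 4" and
    Q' = "\<lambda>\<tau>. \<forall>j<2*n*st. cell \<tau> 8 j = dw d (word (L + L) (j div st)) (j mod st)"], goal_cases)
  case 1
  show ?case
  proof (rule runs_map_loop[where N = "2 * n * st" and
        g = "\<lambda>j. dw d (word (L + L) (j div st)) (j mod st)"], goal_cases)
    case (3 j \<tau>)
    let ?i = "j div st" and ?v = "j mod st"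
    let ?k = "cell \<sigma> 10 ?i" let ?u = "dw d (word L ?k) ?v"
    have i: "?i < 2 * n" and v: "?v \<le> n" using addr_split(1)[of j "2 * n"] addr_split(2)[of j] 3(1) by auto
    have k: "?k < 2 * n" using chosen_less ch i by auto
    have u: "?u \<le> n" using dw_le v by simp
    have "word (L + L) ?i = word L ?i @ word L ?k" using chosen_word ch i by auto
    then have "dw d (word (L + L) ?i) ?v = dw d (word L ?i) ?u" by (simp add: dw_append)
    moreover have "cell \<sigma> 7 (?k * st + ?v) = ?u" "cell \<sigma> 7 (?i * st + ?u) = dw d (word L ?i) ?u"
      using tb k v i u by (auto simp: tabled_def)
    moreover have "?k * st < 2 ^ w" "?k * st + ?v < 2 ^ w" "?i * st < 2 ^ w" "?i * st + ?u < 2 ^ w"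
      using table_less addr_less k v i u by auto
    ultimately show ?case using su 3(3)
      by (simp add: set_up_def agree_offD[OF 3(2)])
  qed (use su table_less[of "2 * n"] in \<open>auto simp: set_up_def agree_off_def intro!: for_cost_mono\<close>)
next
  case (2 \<tau>)
  have su': "set_up \<tau>" using set_up_agree[OF su 2(2)] by simp
  show ?case
  proof (rule runs_map_loop[where N = "2 * n * st" and g = "cell \<tau> 8"], goal_cases)
    case (4 \<rho>)
    then show ?case using 2(1) addr_bound[of _ "2 * n"] addr_div_mod by (simp add: tabled_def)
  qed (use su' table_less[of "2 * n"] in \<open>auto simp: set_up_def agree_off_def intro!: for_cost_mono\<close>)
qed simp

lemma mult_rb_less: "r \<le> 2 * n \<Longrightarrow> r * rb < 2 ^ w"
  using key_less_word[of r 0] by simp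

lemma runs_rerank:
  assumes su: "set_up \<sigma>" and rk: "ranked L \<sigma>" and ch: "\<forall>i<2*n. chosen L \<sigma> i"
  shows "runs w rerank \<sigma> (for_cost (2 * n) 1 10 + for_cost (2 * n) 1 (for_cost (2 * n) 1 10 + 5))
    (ranked (L + L))"
proof -
  define r where "r = cell \<sigma> 6"
  define K where "K i = r i * rb + r (cell \<sigma> 10 i)" for i
  have r: "r i \<le> 2 * n" if "i < 2 * n" for i using rk that by (simp add: ranked_def r_def)
  have c: "cell \<sigma> 10 i < 2 * n" if "i < 2 * n" for i using ch chosen_less that by auto
  have rl: "r i < r j \<longleftrightarrow> word L i < word L j" if "i < 2 * n" "j < 2 * n" for i j
    using rk that by (simp add: ranked_def r_def)
  have re: "r i = r j \<longleftrightarrow> word L i = word L j" if "i < 2 * n" "j < 2 * n" for i j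
    using rl[OF that] rl[OF that(2,1)] by (metis less_irrefl neq_iff)
  have K: "K i < K j \<longleftrightarrow> word (L + L) i < word (L + L) j" if i: "i < 2 * n" and j: "j < 2 * n" for i j
  proof -
    have "word (L + L) i < word (L + L) j \<longleftrightarrow>
        word L i < word L j \<or> word L i = word L j \<and> word L (cell \<sigma> 10 i) < word L (cell \<sigma> 10 j)"
      using chosen_word[OF ch[rule_format, OF i] i] chosen_word[OF ch[rule_format, OF j] j]
        length_word[OF i, of L] length_word[OF j, of L] by (simp add: append_less_append_iff)
    then show ?thesis unfolding K_def using r c i j by (simp add: key_mono rl re)
  qed
  show ?thesis unfolding rerank_def
  proof (rule runs_Seq[where BP = "for_cost (2 * n) 1 10" and
      BR = "for_cost (2 * n) 1 (for_cost (2 * n) 1 10 + 5)" and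
      Q' = "\<lambda>\<tau>. \<forall>i<2*n. cell \<tau> 11 i = K i"], goal_cases)
    case 1
    show ?case
    proof (rule runs_map_loop[where N = "2 * n" and g = K], goal_cases)
      case (3 i \<tau>)
      then show ?case using su r c mult_rb_less[of "r i"] key_less_word[of "r i" "r (cell \<sigma> 10 i)"]
        by (simp add: K_def r_def set_up_def agree_offD[OF 3(2)])
    qed (use su lin_less in \<open>auto simp: set_up_def agree_off_def intro!: for_cost_mono\<close>)
  next
    case (2 \<tau>)
    have su': "set_up \<tau>" using set_up_agree[OF su 2(2)] by simp
    show ?case
    proof (rule runs_Rank[where N = "2 * n" and p = "\<lambda>x y. K y < K x"], goal_cases)
      case (6 x y \<rho>)
      then show ?case using 2(1) by (simp add: agree_offD[OF 6(3)])
    next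
      case (7 \<rho>)
      have "card {y. y < 2 * n \<and> K y < K x} \<le> 2 * n" for x
        using card_mono[of "{..<2 * n}" "{y. y < 2 * n \<and> K y < K x}"] by auto
      then show ?case unfolding ranked_def using 7(2) by (simp add: card_less_iff K)
    qed (use su' lin_less in \<open>auto simp: set_up_def agree_off_def intro!: for_cost_mono\<close>)
  qed simp
qed

lemma runs_double:
  assumes su: "set_up \<sigma>" and rk: "ranked L \<sigma>" and tb: "tabled L \<sigma>"
  shows "runs w double \<sigma> (double_cost n) (\<lambda>\<tau>. ranked (L + L) \<tau> \<and> tabled (L + L) \<tau>)"
  unfolding double_def double_cost_def st_def[symmetric]
proof (rule runs_Seq[where BR = "(for_cost (2 * n * st) 3 20 + for_cost (2 * n * st) 3 4) +
     (for_cost (2 * n) 1 10 + for_cost (2 * n) 1 (for_cost (2 * n) 1 10 + 5))",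
     OF runs_select_nodes[OF su rk tb]], goal_cases)
  case (1 \<tau>)
  note off = 1(2)[unfolded select_nodes_def, simplified]
  have tb1: "tabled L \<tau>" and rk1: "ranked L \<tau>" using tb rk off by (auto simp: tabled_def ranked_def agree_off_def)
  have su1: "set_up \<tau>" using set_up_agree[OF su off] by simp
  show ?case
  proof (rule runs_Seq[where BR = "for_cost (2 * n) 1 10 + for_cost (2 * n) 1 (for_cost (2 * n) 1 10 + 5)",
      OF runs_compose[OF su1 tb1 1(1)]], goal_cases)
    case (1 \<rho>)
    note off' = 1(2)[unfolded compose_def, simplified]
    have su2: "set_up \<rho>" using set_up_agree[OF su1 off'] by simp
    have "ranked L \<rho>" "\<forall>i<2*n. chosen L \<rho> i"
      using rk1 \<open>\<forall>i<2*n. chosen L \<tau> i\<close> off' by (auto simp: ranked_def chosen_def agree_off_def)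
    from runs_agree_off[OF runs_rerank[OF su2 this]] show ?case
      by (rule runs_mono) (use 1(1) in \<open>auto simp: rerank_def tabled_def agree_off_def\<close>)
  qed (rule order_refl)
qed simp

lemma runs_iterate:
  assumes su: "set_up \<sigma>" and rk: "ranked 1 \<sigma>" and tb: "tabled 1 \<sigma>" and M: "2 * n \<le> 2 ^ M"
  shows "runs w iterate \<sigma> (M * (double_cost n + 8) + 6) (\<lambda>\<tau>. \<exists>L\<ge>2*n. ranked L \<tau>)"
  unfolding iterate_def
proof (rule runs_Seq[where BP = 2 and BR = "M * (double_cost n + 8) + 4" and
    Q' = "\<lambda>\<tau>. reg \<tau> 7 = 1"], goal_cases)
  case 1
  show ?case by (intro runs_SetReg) auto
next
  case (2 \<tau>)
  let ?I = "\<lambda>k \<rho>. reg \<rho> 7 = 2 ^ k \<and> ranked (2 ^ k) \<rho> \<and> tabled (2 ^ k) \<rho> \<and> set_up \<rho>"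
  have "runs w (While (Less (Reg 7) (Reg 8)) (double ;; SetReg 7 (Add (Reg 7) (Reg 7)))) \<tau>
      (M * ((double_cost n + 4) + bcost (Less (Reg 7) (Reg 8)) + 1) + bcost (Less (Reg 7) (Reg 8)) + 1)
      (\<lambda>\<rho>. \<not> bval w \<rho> (Less (Reg 7) (Reg 8)) \<and> (\<exists>k. ?I k \<rho>))"
  proof (rule runs_While, goal_cases)
    case (1 k \<rho>)
    then have k: "2 ^ k < 2 * n" by (simp add: set_up_def)
    with M have "2 ^ k < (2::nat) ^ M" by linarith
    then have "k < M" by simp
    moreover have "runs w (double ;; SetReg 7 (Add (Reg 7) (Reg 7))) \<rho> (double_cost n + 4) (?I (Suc k))"
    proof (rule runs_Seq[where BR = 4, OF runs_double[of \<rho> "2 ^ k"]], goal_cases)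
      case (4 \<rho>')
      then have off: "agree_off {3, 4, 5, 6} {6, 7, 8, 10, 11} \<rho> \<rho>'"
        by (auto simp: double_def select_nodes_def compose_def rerank_def agree_off_def)
      have "reg \<rho>' 7 = 2 ^ k" "set_up \<rho>'" using off set_up_agree[OF _ off] 1(1) by (auto simp: agree_off_def)
      moreover have "2 ^ k + 2 ^ k < (2::nat) ^ w" using k lin_less[of "2 ^ k + 2 ^ k"] by linarith
      ultimately show ?case using 4(1) by (intro runs_SetReg)
        (auto simp: set_up_def ranked_def tabled_def mult_2)
    qed (use 1 in auto)
    ultimately show ?case by blast
  next
    case 2
    have "ranked 1 \<tau>" "tabled 1 \<tau>" "set_up \<tau>"
      using \<open>agree_off _ _ \<sigma> \<tau>\<close> rk tb su by (auto simp: agree_off_def ranked_def tabled_def set_up_def)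
    then show ?case using \<open>reg \<tau> 7 = 1\<close> by simp
  qed
  then show ?case
  proof (rule runs_mono, goal_cases)
    case (2 \<rho>)
    then obtain k where "?I k \<rho>" "\<not> 2 ^ k < 2 * n" by (auto simp: set_up_def)
    then show ?case by (intro exI[of _ "2 ^ k"]) auto
  qed simp
qed simp

lemma runs_first_fit:
  assumes su: "set_up \<sigma>" and r: "\<forall>i<2*n. cell \<sigma> 6 i \<le> 2 * n"
    and lohi: "\<And>x. x < n \<Longrightarrow> cell \<sigma> 6 x \<le> cell \<sigma> 6 (n + x)"
    and K: "\<forall>x<n. cell \<sigma> 11 x = cell \<sigma> 6 x * rb + cell \<sigma> 6 (n + x)"
    and g: "greedy_state n (cell \<sigma> 6) (\<lambda>x. cell \<sigma> 6 (n + x)) (cell \<sigma> 4) (cell \<sigma> 12) t M"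
    and t: "t < n"
  shows "runs w first_fit \<sigma> (for_cost n 1 15 + (10 * n + 23))
    (\<lambda>\<tau>. \<exists>M'. greedy_state n (cell \<sigma> 6) (\<lambda>x. cell \<sigma> 6 (n + x)) (cell \<tau> 4) (cell \<tau> 12) (Suc t) M')"
    (is "runs w _ \<sigma> _ ?Q")
proof -
  let ?lo = "cell \<sigma> 6" and ?hi = "\<lambda>x. cell \<sigma> 6 (n + x)" and ?out = "cell \<sigma> 4"
  have "\<exists>x<n. ?out x = 0"
  proof (rule ccontr)
    assume "\<not> ?thesis"
    then have "{x. x < n \<and> ?out x \<noteq> 0} = {..<n}" by auto
    with g t show False by (auto simp: greedy_state_def)
  qed
  note free = this
  have Mn: "M \<le> n" using greedy_state_bound[OF g] .
  have Kless: "cell \<sigma> 11 x < rb * rb" if "x < n" for x using K r that key_less by simp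
  let ?best = "\<lambda>u. u < n \<and> ?out u = 0 \<and>
    (\<forall>y<n. ?out y = 0 \<longrightarrow> ?lo u < ?lo y \<or> ?lo u = ?lo y \<and> ?hi u \<le> ?hi y)"
  have best: "?best u" if "u < n" "?out u = 0" "\<And>y. y < n \<Longrightarrow> ?out y = 0 \<Longrightarrow> cell \<sigma> 11 u \<le> cell \<sigma> 11 y" for u
  proof -
    have "?lo u < ?lo y \<or> ?lo u = ?lo y \<and> ?hi u \<le> ?hi y" if y: "y < n" "?out y = 0" for y
      using \<open>\<And>y. y < n \<Longrightarrow> ?out y = 0 \<Longrightarrow> cell \<sigma> 11 u \<le> cell \<sigma> 11 y\<close>[OF y]
        key_mono[of "?hi y" "?hi u" "?lo y" "?lo u"] K r \<open>u < n\<close> y by auto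
    with that show ?thesis by blast
  qed
  show ?thesis unfolding first_fit_def
  proof (rule runs_Seq[where BP = 4 and BR = "for_cost n 1 15 + (10 * n + 19)" and
      Q' = "\<lambda>\<tau>. reg \<tau> 5 = rb * rb"], goal_cases)
    case 1
    show ?case using su rb_sq_less by (intro runs_SetReg) (auto simp: set_up_def)
  next
    case (2 \<tau>1)
    note off1 = 2(2)[simplified]
    have su1: "set_up \<tau>1" using set_up_agree[OF su off1] by simp
    have c1: "cell \<tau>1 = cell \<sigma>" using off1 by (auto simp: agree_off_def)
    show ?case
    proof (rule runs_Seq[where BP = "for_cost n 1 15" and BR = "10 * n + 19" and
        Q' = "\<lambda>\<tau>. ?best (reg \<tau> 6)"], goal_cases)
      case 1
      show ?case
      proof (rule runs_Argmin[where N = n and p = "\<lambda>x. ?out x = 0" and g = "cell \<sigma> 11"], goal_cases)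
        case (8 x)
        then show ?case using Kless 2(1) by simp
      next
        case (10 \<tau>)
        then show ?case using best by blast
      qed (use su1 c1 lin_less free in \<open>auto simp: set_up_def agree_off_def intro!: for_cost_mono\<close>)
    next
      case (2 \<tau>2)
      note off2 = 2(2)[simplified]
      have su2: "set_up \<tau>2" using set_up_agree[OF su1 off2] by simp
      have c2: "cell \<tau>2 = cell \<sigma>" using off2 c1 by (auto simp: agree_off_def)
      define u where "u = reg \<tau>2 6"
      have u: "?best u" using 2(1) by (simp add: u_def)
      show ?case
      proof (rule runs_Seq[where BP = 2 and BR = "10 * n + 17" and Q' = "\<lambda>\<tau>. reg \<tau> 10 = 0"], goal_cases)
        case 1
        show ?case by (intro runs_SetReg) auto
      next
        case (2 \<tau>3)
        note off3 = 2(2)[simplified]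
        have su3: "set_up \<tau>3" using set_up_agree[OF su2 off3] by simp
        have c3: "cell \<tau>3 = cell \<sigma>" "reg \<tau>3 6 = u" using off3 c2 by (auto simp: agree_off_def u_def)
        let ?b = "Less (Cell 6 (Reg 6)) (Cell 12 (Reg 10))"
        let ?I = "\<lambda>c \<tau>. reg \<tau> 10 = c \<and> c \<le> M \<and> (\<forall>c'<c. ?lo u < cell \<sigma> 12 c') \<and>
          cell \<tau> = cell \<sigma> \<and> reg \<tau> 6 = u"
        have W: "runs w (While ?b (SetReg 10 (Add (Reg 10) (Lit 1)))) \<tau>3 (n * (4 + bcost ?b + 1) + bcost ?b + 1)
           (\<lambda>\<tau>. \<not> bval w \<tau> ?b \<and> (\<exists>c. ?I c \<tau>))"
        proof (rule runs_While, goal_cases)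
          case (1 c \<tau>)
          then have lt: "?lo u < cell \<sigma> 12 c" by auto
          have "c < M"
          proof (rule ccontr)
            assume "\<not> c < M"
            then have "cell \<sigma> 12 c = 0" using g by (simp add: greedy_state_def)
            with lt show False by simp
          qed
          moreover have "Suc c < 2 ^ w" using \<open>c < M\<close> Mn by (intro lin_less) simp
          ultimately show ?case using 1 lt Mn
            by (intro conjI runs_SetReg) (auto simp: less_Suc_eq)
        next
          case 2
          show ?case using \<open>reg \<tau>3 10 = 0\<close> c3 by simp
        qed
        show ?case
        proof (rule runs_Seq[where BP = "10 * n + 6" and BR = 11 and
            Q' = "\<lambda>\<tau>. \<not> bval w \<tau> ?b \<and> (\<exists>c. ?I c \<tau>)"], goal_cases)
          case 1
          show ?case by (rule runs_mono[OF W]) (simp, assumption)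
        next
          case (2 \<tau>4)
          then obtain c where I: "?I c \<tau>4" by blast
          then have ends: "cell \<sigma> 12 c \<le> ?lo u" using 2(1) by auto
          have su4: "set_up \<tau>4" using set_up_agree[OF su3 2(2)] by simp
          have cn: "Suc c < 2 ^ w" "n + u < 2 ^ w" using I Mn u lin_less by auto
          obtain M' where M': "greedy_state n ?lo ?hi (?out(u := Suc c)) ((cell \<sigma> 12)(c := ?hi u)) (Suc t) M'"
            using greedy_state_step[OF g, of u c] u lohi I ends by auto
          show ?case
          proof (rule runs_Seq[where BP = 6 and BR = 5 and Q' = "\<lambda>\<tau>. cell \<tau> 12 = (cell \<sigma> 12)(c := ?hi u)"],
              goal_cases)
            case 1
            show ?case using I su4 cn by (intro runs_SetCell) (auto simp: set_up_def)
          next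
            case (2 \<tau>5)
            then have "cell \<tau>5 4 = ?out" "reg \<tau>5 6 = u" "reg \<tau>5 10 = c"
              using I by (auto simp: agree_off_def)
            then show ?case using 2(1) M' cn by (intro runs_SetCell) (auto simp: fun_upd_def)
          qed simp
        qed simp
      qed simp
    qed simp
  qed simp
qed

lemma ranked_lo_le_hi: "ranked L \<sigma> \<Longrightarrow> x < n \<Longrightarrow> cell \<sigma> 6 x \<le> cell \<sigma> 6 (n + x)"
proof -
  assume "ranked L \<sigma>" and x: "x < n"
  then have "cell \<sigma> 6 (n + x) < cell \<sigma> 6 x \<longleftrightarrow> word L (n + x) < word L x" by (simp add: ranked_def)
  then show ?thesis using lo_le_hi[OF x, of L] by (simp add: not_less[symmetric])
qed

lemma runs_color:
  assumes su: "set_up \<sigma>" and rk: "ranked L \<sigma>" and "cell \<sigma> 4 = (\<lambda>_. 0)" "cell \<sigma> 12 = (\<lambda>_. 0)"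
  shows "runs w color \<sigma> (for_cost n 1 11 + for_cost n 1 (for_cost n 1 15 + (10 * n + 23)))
    (\<lambda>\<tau>. \<exists>M. interval_coloring n (cell \<sigma> 6) (\<lambda>x. cell \<sigma> 6 (n + x)) (cell \<tau> 4) M \<and>
      (\<forall>x<n. cell \<tau> 4 x \<noteq> 0))"
  unfolding color_def
proof (rule runs_Seq[where BP = "for_cost n 1 11" and BR = "for_cost n 1 (for_cost n 1 15 + (10 * n + 23))" and
    Q' = "\<lambda>\<tau>. \<forall>x<n. cell \<tau> 11 x = cell \<sigma> 6 x * rb + cell \<sigma> 6 (n + x)"], goal_cases)
  case 1
  have r: "cell \<sigma> 6 i \<le> 2 * n" if "i < 2 * n" for i using rk that by (simp add: ranked_def)
  show ?case
  proof (rule runs_map_loop[where N = n and g = "\<lambda>x. cell \<sigma> 6 x * rb + cell \<sigma> 6 (n + x)"], goal_cases)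
    case (3 x \<tau>)
    then show ?case using su mult_rb_less[OF r[of x]] key_less_word[OF r[of x] r[of "n + x"]] lin_less[of "n + x"]
      by (simp add: set_up_def agree_offD[OF 3(2)])
  qed (use su lin_less in \<open>auto simp: set_up_def agree_off_def intro!: for_cost_mono\<close>)
next
  case (2 \<tau>)
  note off = 2(2)[simplified]
  have su1: "set_up \<tau>" using set_up_agree[OF su off] by simp
  let ?lo = "cell \<sigma> 6" and ?hi = "\<lambda>x. cell \<sigma> 6 (n + x)"
  show ?case
  proof (rule runs_For[where N = n and B = "for_cost n 1 15 + (10 * n + 23)" and
      I = "\<lambda>t \<rho>. \<exists>M. greedy_state n ?lo ?hi (cell \<rho> 4) (cell \<rho> 12) t M"], goal_cases)
    case 4
    have "cell \<tau> 4 = (\<lambda>_. 0)" "cell \<tau> 12 = (\<lambda>_. 0)" using assms(3,4) off by (auto simp: agree_off_def)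
    then show ?case using greedy_state_0 by auto
  next
    case (5 t \<rho>)
    have su2: "set_up \<rho>" using set_up_agree[OF su1 5(4)] by (simp add: first_fit_def)
    have c: "cell \<rho> 6 = cell \<sigma> 6" "cell \<rho> 11 = cell \<tau> 11"
      using 5(4) off by (auto simp: agree_off_def first_fit_def)
    from 5(2) obtain M where "greedy_state n ?lo ?hi (cell \<rho> 4) (cell \<rho> 12) t M" by blast
    with runs_first_fit[OF su2, of t M] ranked_lo_le_hi[OF rk] rk 2(1) c 5(1) show ?case
      by (simp add: ranked_def)
  next
    case (6 \<rho>)
    then obtain M where M: "greedy_state n ?lo ?hi (cell \<rho> 4) (cell \<rho> 12) n M" by blast
    then have "card {x. x < n \<and> cell \<rho> 4 x \<noteq> 0} = card {..<n}" by (simp add: greedy_state_def)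
    then have "{x. x < n \<and> cell \<rho> 4 x \<noteq> 0} = {..<n}" by (intro card_subset_eq) auto
    with M show ?case by (auto simp: greedy_state_def)
  qed (use su1 lin_less in \<open>auto simp: set_up_def agree_off_def first_fit_def intro!: for_cost_mono\<close>)
qed simp

lemma minimum_partition:
  assumes rk: "ranked L \<sigma>" and L: "2 * n \<le> L"
    and col: "interval_coloring n (cell \<sigma> 6) (\<lambda>x. cell \<sigma> 6 (n + x)) (cell \<tau> 4) M"
    and all: "\<forall>x<n. cell \<tau> 4 x \<noteq> 0"
  shows "minimum_chain_partition A (output_partition A idx \<tau>)"
proof -
  let ?out = "\<lambda>p. cell \<tau> 4 (idx p)"
  have sl: "state_less A p q \<longleftrightarrow> idx p \<noteq> idx q \<and> cell \<sigma> 6 (n + idx p) \<le> cell \<sigma> 6 (idx q)"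
    if pq: "p \<in> states A" "q \<in> states A" for p q
  proof -
    have "n + idx p < 2 * n" "idx q < 2 * n" using idx_less pq by (auto simp: mult_2 intro: trans_less_add1)
    then have "word L (n + idx p) \<le> word L (idx q) \<longleftrightarrow> cell \<sigma> 6 (n + idx p) \<le> cell \<sigma> 6 (idx q)"
      using rk unfolding ranked_def by (meson not_le)
    then show ?thesis
      using state_less_iff_words[OF pq] all_less_iff[OF L idx_less[OF pq(1)] idx_less[OF pq(2)]] by simp
  qed
  have fin: "finite (states A)" using wf by (simp add: wf_dfa_def)
  have part: "partition_on (states A) (output_partition A idx \<tau>)"
    unfolding output_partition_def
    by (rule partition_onI) (auto simp: disjnt_def)
  have chain: "totalp_on C (state_less A)" if "C \<in> output_partition A idx \<tau>" for C
  proof (rule totalp_onI)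
    fix p q assume "p \<in> C" "q \<in> C" "p \<noteq> q"
    with that have pq: "p \<in> states A" "q \<in> states A" "?out p = ?out q" by (auto simp: output_partition_def)
    then have "idx p \<noteq> idx q" "idx p < n" "idx q < n" using idx_inj idx_less \<open>p \<noteq> q\<close> by auto
    with col all pq show "state_less A p q \<or> state_less A q p"
      by (auto simp: sl interval_coloring_def)
  qed
  have "output_partition A idx \<tau> = (\<lambda>l. {v \<in> states A. ?out v = l}) ` ?out ` states A"
    by (simp add: output_partition_def image_image)
  then have "card (output_partition A idx \<tau>) \<le> card (?out ` states A)"
    using fin by (simp add: card_image_le)
  also have "?out ` states A \<subseteq> {1..M}"
    using col all idx_less by (auto simp: interval_coloring_def Suc_le_eq)
  then have "card (?out ` states A) \<le> card {1..M}" by (intro card_mono) auto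
  also have "card {1..M} = M" by simp
  finally have upper: "card (output_partition A idx \<tau>) \<le> M" .
  have "M \<le> card \<D>" if D: "chain_partition A \<D>" for \<D>
  proof -
    from col obtain S where "S \<subseteq> {x. x < n \<and> cell \<tau> 4 x \<noteq> 0}" "card S = M"
      and anti: "\<forall>x\<in>S. \<forall>y\<in>S. x \<noteq> y \<longrightarrow> \<not> cell \<sigma> 6 (n + x) \<le> cell \<sigma> 6 y"
      unfolding interval_coloring_def by (elim conjE exE)
    then have S: "S \<subseteq> {..<n}" "card S = M" by auto
    have P: "partition_on (states A) \<D>" using D by (simp add: chain_partition_def)
    have "\<forall>x\<in>S. \<exists>C\<in>\<D>. \<exists>p\<in>C. idx p = x"
      using S(1) idx_surj partition_onD1[OF P] by (metis UnionE lessThan_iff subsetD)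
    then obtain f where f: "\<And>x. x \<in> S \<Longrightarrow> f x \<in> \<D> \<and> (\<exists>p\<in>f x. idx p = x)" by metis
    have "inj_on f S"
    proof (rule inj_onI, rule ccontr)
      fix x y assume xy: "x \<in> S" "y \<in> S" "f x = f y" "x \<noteq> y"
      with f[of x] f[of y] obtain p q where pq: "p \<in> f x" "q \<in> f x" "idx p = x" "idx q = y" by auto
      have "f x \<in> \<D>" using f xy by blast
      then have "totalp_on (f x) (state_less A)" using D by (simp add: chain_partition_def)
      then have "state_less A p q \<or> state_less A q p" using pq xy(4) by (auto dest: totalp_onD)
      moreover have "p \<in> states A" "q \<in> states A" using pq \<open>f x \<in> \<D>\<close> partition_onD1[OF P] by auto
      ultimately show False using sl anti xy pq by metis
    qed
    moreover have "f ` S \<subseteq> \<D>" using f by auto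
    moreover have "finite \<D>" using fin P by (rule finite_elements)
    ultimately show ?thesis using S(2) by (metis card_inj_on_le)
  qed
  with upper have "\<forall>\<D>. chain_partition A \<D> \<longrightarrow> card (output_partition A idx \<tau>) \<le> card \<D>"
    by (blast intro: order_trans)
  with part chain show ?thesis unfolding minimum_chain_partition_def chain_partition_def by blast
qed

definition base :: "store \<Rightarrow> bool" where
  "base \<tau> \<longleftrightarrow> set_up \<tau> \<and> edges_stored \<tau> \<and> cell \<tau> 4 = (\<lambda>_. 0) \<and> cell \<tau> 12 = (\<lambda>_. 0)"

lemma base_agree:
  "base \<sigma> \<Longrightarrow> agree_off X Y \<sigma> \<tau> \<Longrightarrow> {0, 1, 2, 8, 9, 11} \<inter> X = {} \<Longrightarrow> {0, 1, 2, 4, 12} \<inter> Y = {} \<Longrightarrow> base \<tau>"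
  using set_up_agree[of \<sigma> X Y \<tau>] edges_stored_agree[of \<sigma> X Y \<tau>] by (auto simp: base_def agree_off_def)

lemma runs_program:
  assumes M: "2 * n \<le> 2 ^ M"
  shows "runs w program (input_store A idx code es) (program_cost n M)
    (\<lambda>\<tau>. minimum_chain_partition A (output_partition A idx \<tau>))"
  unfolding program_def program_cost_def st_def[symmetric]
proof (rule runs_Seq[OF runs_prepare _ order_refl], goal_cases)
  case (1 \<tau>0)
  then have b0: "base \<tau>0" "cell \<tau>0 5 = (\<lambda>_. 0)" by (auto simp: base_def)
  have es_le: "for_cost (length es) 1 k \<le> for_cost (n ^ 2) 1 k" for k
    using length_es by (intro for_cost_mono) auto
  have "runs w load_labels \<tau>0 (for_cost (n ^ 2) 1 5) (\<lambda>\<tau>. cell \<tau> 5 = lcode)"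
    using runs_mono[OF runs_load_labels[of \<tau>0] es_le] b0 by (simp add: base_def)
  then show ?case
  proof (rule runs_Seq[OF _ _ order_refl], goal_cases)
    case (1 \<tau>1)
    have b1: "base \<tau>1" by (rule base_agree[OF b0(1) 1(2)]) (auto simp: load_labels_def)
    then have "runs w rank_labels \<tau>1 (for_cost n 1 (for_cost n 1 16 + 5) + 3) (\<lambda>\<tau>. \<forall>u<n. cell \<tau> 14 u = lab u)"
      using runs_rank_labels 1(1) by (simp add: base_def)
    then show ?case
    proof (rule runs_Seq[OF _ _ order_refl], goal_cases)
      case (1 \<tau>2)
      have b2: "base \<tau>2" by (rule base_agree[OF b1 1(2)]) (auto simp: rank_labels_def)
      have su2: "set_up \<tau>2" using b2 by (simp add: base_def)
      from runs_load_ranks[OF su2 1(1)] show ?case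
      proof (rule runs_Seq[OF _ _ order_refl], goal_cases)
        case (1 \<tau>3)
        note off3 = 1(2)[unfolded load_ranks_def, simplified]
        have b3: "base \<tau>3" by (rule base_agree[OF b2 off3]) auto
        have l3: "\<forall>u<n. cell \<tau>3 14 u = lab u" using \<open>\<forall>u<n. cell \<tau>2 14 u = lab u\<close> off3
          by (auto simp: agree_off_def)
        have "runs w load_letters \<tau>3 (for_cost (st * st) 3 3 + for_cost (n ^ 2) 1 13 + 3)
            (\<lambda>\<tau>. \<forall>c\<le>n. \<forall>v\<le>n. cell \<tau> 13 (c * st + v) = d c v)"
          by (rule runs_mono[OF runs_load_letters]) (use b3 l3 es_le in \<open>auto simp: base_def\<close>)
        then show ?case
        proof (rule runs_Seq[OF _ _ order_refl], goal_cases)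
          case (1 \<tau>4)
          note off4 = 1(2)[unfolded load_letters_def, simplified]
          have b4: "base \<tau>4" by (rule base_agree[OF b3 off4]) auto
          have r4: "ranked 1 \<tau>4" "\<forall>i<2*n. cell \<tau>4 6 i = lab (i mod n)"
            using \<open>ranked 1 \<tau>3 \<and> _\<close> off4 by (auto simp: ranked_def agree_off_def)
          have "set_up \<tau>4" using b4 by (simp add: base_def)
          from runs_load_table[OF this r4(2) 1(1)] show ?case
          proof (rule runs_Seq[OF _ _ order_refl], goal_cases)
            case (1 \<tau>5)
            note off5 = 1(2)[unfolded load_table_def, simplified]
            have b5: "base \<tau>5" by (rule base_agree[OF b4 off5]) auto
            have r5: "ranked 1 \<tau>5" using r4 off5 by (auto simp: ranked_def agree_off_def)
            have "set_up \<tau>5" using b5 by (simp add: base_def)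
            from runs_iterate[OF this r5 1(1) M] show ?case
            proof (rule runs_Seq[OF _ _ order_refl], goal_cases)
              case (1 \<tau>6)
              note off6 = 1(2)[unfolded iterate_def double_def select_nodes_def compose_def rerank_def, simplified]
              have b6: "base \<tau>6" by (rule base_agree[OF b5 off6]) auto
              from 1(1) obtain L where L: "2 * n \<le> L" "ranked L \<tau>6" by blast
              have "runs w color \<tau>6 (for_cost n 1 11 + for_cost n 1 (for_cost n 1 15 + (10 * n + 23)))
                (\<lambda>\<tau>. \<exists>M. interval_coloring n (cell \<tau>6 6) (\<lambda>x. cell \<tau>6 6 (n + x)) (cell \<tau> 4) M \<and>
                  (\<forall>x<n. cell \<tau> 4 x \<noteq> 0))"
                using b6 by (intro runs_color[OF _ L(2)]) (auto simp: base_def)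
              then show ?case
                by (rule runs_mono) (use minimum_partition[OF L(2,1)] in auto)
            qed
          qed
        qed
      qed
    qed
  qed
qed

end

definition rounds :: "nat \<Rightarrow> nat" where
  "rounds k = nat \<lceil>log 2 (real (2 * k))\<rceil>"

lemma two_power_rounds: "2 * k \<le> 2 ^ rounds k"
proof (cases "k = 0")
  case False
  then have "real (2 * k) = 2 powr log 2 (real (2 * k))" by simp
  also have "\<dots> \<le> 2 powr real (rounds k)" unfolding rounds_def by (intro powr_mono) linarith+
  also have "\<dots> = real (2 ^ rounds k)" by (simp add: powr_realpow)
  finally show ?thesis by (simp only: of_nat_le_iff)
qed simp

lemma rounds_le: "2 \<le> k \<Longrightarrow> real (rounds k) \<le> 3 / ln 2 * ln (real k)"
proof -
  assume k: "2 \<le> k"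
  then have "log 2 (real (2 * k)) = 1 + log 2 (real k)" by (simp add: log_mult)
  moreover have "1 \<le> log 2 (real k)" using k by (simp add: le_log_iff)
  ultimately have "real (rounds k) \<le> 3 * log 2 (real k)" unfolding rounds_def by linarith
  then show ?thesis by (simp add: log_def)
qed

lemma double_cost_le: "1 \<le> k \<Longrightarrow> double_cost k \<le> 1000 * k ^ 2"
proof -
  assume "1 \<le> k"
  then obtain j where "k = Suc j" by (cases k) auto
  then show ?thesis by (simp add: double_cost_def for_cost_def algebra_simps power2_eq_square)
qed

lemma program_cost_le: "1 \<le> k \<Longrightarrow> program_cost k M \<le> 1000 * k ^ 2 + M * (1008 * k ^ 2)"
proof -
  assume k: "1 \<le> k"
  then obtain j where j: "k = Suc j" by (cases k) auto
  have "program_cost k 0 \<le> 1000 * k ^ 2"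
    unfolding j by (simp add: program_cost_def for_cost_def algebra_simps power2_eq_square)
  moreover have "1 \<le> k ^ 2" using k by simp
  then have "double_cost k + 8 \<le> 1008 * k ^ 2" using double_cost_le[OF k] by linarith
  then have "M * (double_cost k + 8) \<le> M * (1008 * k ^ 2)" by (rule mult_le_mono2)
  moreover have "program_cost k M = program_cost k 0 + M * (double_cost k + 8)"
    by (simp add: program_cost_def)
  ultimately show ?thesis by linarith
qed

lemma program_cost_bigo:
  "(\<lambda>k. real (program_cost k (rounds k))) \<in> O(\<lambda>k. real k ^ 2 * ln (real k))"
proof (rule bigoI)
  show "\<forall>\<^sub>F k in at_top. norm (real (program_cost k (rounds k))) \<le>
      (4024 / ln 2) * norm (real k ^ 2 * ln (real k))"
    using eventually_ge_at_top[of "2::nat"]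
  proof eventually_elim
    case (elim k)
    have ln: "ln 2 \<le> ln (real k)" using elim by simp
    have "real (program_cost k (rounds k)) \<le> real (1000 * k ^ 2 + rounds k * (1008 * k ^ 2))"
      using program_cost_le[of k "rounds k"] elim by (simp only: of_nat_le_iff)
    also have "\<dots> = (1000 + 1008 * real (rounds k)) * real k ^ 2" by (simp add: algebra_simps)
    also have "\<dots> \<le> (1000 * (ln (real k) / ln 2) + 1008 * (3 / ln 2 * ln (real k))) * real k ^ 2"
      using rounds_le[OF elim] ln by (intro mult_right_mono add_mono mult_left_mono) (auto simp: field_simps)
    also have "\<dots> = (4024 / ln 2) * (real k ^ 2 * ln (real k))" by (simp add: field_simps)
    finally show ?case using elim by simp
  qed
qed

theorem theorem19:
  "\<exists>(P :: com) (k :: nat) (T :: nat \<Rightarrow> nat).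
     (\<lambda>n. real (T n)) \<in> O(\<lambda>n. real n ^ 2 * ln (real n)) \<and>
     (\<forall>(A :: ('q, 'a::linorder) dfa) idx code es w.
        wf_dfa A \<and> init_has_no_incoming A \<and> all_reachable A \<and> input_consistent A \<and>
        dfa_encoding w A idx code es \<and> (card (states A) + 2) ^ k \<le> 2 ^ w \<longrightarrow>
        (\<exists>t \<tau>. exec w P (input_store A idx code es) t \<tau> \<and> t \<le> T (card (states A)) \<and>
           minimum_chain_partition A (output_partition A idx \<tau>)))"
proof (rule exI[of _ program], rule exI[of _ 4], rule exI[of _ "\<lambda>k. program_cost k (rounds k)"],
    intro conjI allI impI)
  show "(\<lambda>k. real (program_cost k (rounds k))) \<in> O(\<lambda>k. real k ^ 2 * ln (real k))"
    by (rule program_cost_bigo)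
next
  fix A :: "('q, 'a) dfa" and idx code es w
  assume *: "wf_dfa A \<and> init_has_no_incoming A \<and> all_reachable A \<and> input_consistent A \<and>
    dfa_encoding w A idx code es \<and> (card (states A) + 2) ^ 4 \<le> 2 ^ w"
  interpret sized_dfa A idx code es w by unfold_locales (use * in auto)
  show "\<exists>t \<tau>. exec w program (input_store A idx code es) t \<tau> \<and>
      t \<le> program_cost (card (states A)) (rounds (card (states A))) \<and>
      minimum_chain_partition A (output_partition A idx \<tau>)"
    using runs_program[OF two_power_rounds] by (simp add: runs_def n_def)
qed

end
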